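(* Let $\Omega_u,\Omega_d$ be complex $3\times3$ matrices, transforming under $G_F=U(3)_Q\times U(3)_u\times U(3)_d$ by $\Omega_u\mapsto G_Q\Omega_uG_u^\dagger$, $\Omega_d\mapsto G_Q\Omega_dG_d^\dagger$, and put $X_f=\Omega_f\Omega_f^\dagger$. Write singular value decompositions $\Omega_f=U_fD_fW_f^\dagger$ with $U_f,W_f\in U(3)$ and $D_f$ nonnegative diagonal. Then every $G_F$-invariant polynomial, of any degree, in the entries of $\Omega_u,\Omega_d$ and of their adjoints depends only on traces of words in $X_u,X_d$; in particular it is independent of $W_u$ and $W_d$. If the right factors $U(3)_u,U(3)_d$ are replaced by $SU(3)_u,SU(3)_d$, an invariant polynomial may depend in addition on $\det\Omega_u$ and $\det\Omega_d$ (the sectoral determinant phases), but not otherwise on $W_u,W_d$.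
   Context: "Words in $X_u,X_d$" means finite noncommutative products of $X_u$ and $X_d$. The $W_f$ are the right frames (right singular vectors) of $\Omega_f$. *)

theory Defs
  imports "HOL-Analysis.Analysis"
begin

type_synonym cmat3 = "complex^3^3"

definition dagger :: "cmat3 \<Rightarrow> cmat3" where
  "dagger A = (\<chi> i j. cnj (A $ j $ i))"

definition U3 :: "cmat3 set" where
  "U3 = {G. G ** dagger G = mat 1 \<and> dagger G ** G = mat 1}"

definition SU3 :: "cmat3 set" where
  "SU3 = {G \<in> U3. det G = 1}"

definition nonneg_diagonal :: "cmat3 \<Rightarrow> bool" where
  "nonneg_diagonal D \<longleftrightarrow>
     (\<forall>i j. i \<noteq> j \<longrightarrow> D $ i $ j = 0) \<and> (\<forall>i. D $ i $ i \<in> \<real>\<^sub>\<ge>\<^sub>0)"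

definition is_svd :: "cmat3 \<Rightarrow> cmat3 \<Rightarrow> cmat3 \<Rightarrow> cmat3 \<Rightarrow> bool" where
  "is_svd \<Omega> U D W \<longleftrightarrow>
     U \<in> U3 \<and> nonneg_diagonal D \<and> W \<in> U3 \<and> \<Omega> = U ** D ** dagger W"


text \<open>Throughout, a pair of matrices is \<open>(\<Omega>\<^sub>u, \<Omega>\<^sub>d)\<close> and a triple of group elements is
  \<open>(G\<^sub>Q, G\<^sub>u, G\<^sub>d)\<close>.\<close>

definition G_F :: "(cmat3 \<times> cmat3 \<times> cmat3) set" where
  "G_F = U3 \<times> U3 \<times> U3"

definition SG_F :: "(cmat3 \<times> cmat3 \<times> cmat3) set" where
  "SG_F = U3 \<times> SU3 \<times> SU3"

fun flavour_act :: "cmat3 \<times> cmat3 \<times> cmat3 \<Rightarrow> cmat3 \<times> cmat3 \<Rightarrow> cmat3 \<times> cmat3" where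
  "flavour_act (GQ, Gu, Gd) (\<Omega>u, \<Omega>d) = (GQ ** \<Omega>u ** dagger Gu, GQ ** \<Omega>d ** dagger Gd)"

definition flavour_invariant ::
    "(cmat3 \<times> cmat3 \<times> cmat3) set \<Rightarrow> (cmat3 \<times> cmat3 \<Rightarrow> complex) \<Rightarrow> bool" where
  "flavour_invariant G p \<longleftrightarrow> (\<forall>g\<in>G. \<forall>\<Omega>. p (flavour_act g \<Omega>) = p \<Omega>)"


text \<open>The complex polynomial expressions in a set \<open>S\<close> of complex-valued functions, i.e. the
  unital subalgebra generated by \<open>S\<close> under pointwise operations.\<close>

inductive_set polys_in :: "('a \<Rightarrow> complex) set \<Rightarrow> ('a \<Rightarrow> complex) set"
  for S :: "('a \<Rightarrow> complex) set" where
  const: "(\<lambda>_. c) \<in> polys_in S"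
| gen: "f \<in> S \<Longrightarrow> f \<in> polys_in S"
| add: "f \<in> polys_in S \<Longrightarrow> g \<in> polys_in S \<Longrightarrow> (\<lambda>x. f x + g x) \<in> polys_in S"
| mult: "f \<in> polys_in S \<Longrightarrow> g \<in> polys_in S \<Longrightarrow> (\<lambda>x. f x * g x) \<in> polys_in S"

text \<open>A polynomial in the entries and the entries of the adjoints is identified with the function
  it induces; nothing is lost, since these 36 functions are algebraically independent over the
  complex numbers.\<close>

definition matrix_entries :: "(cmat3 \<times> cmat3 \<Rightarrow> complex) set" where
  "matrix_entries =
     (\<Union>i j. {\<lambda>(\<Omega>u, \<Omega>d). \<Omega>u $ i $ j, \<lambda>(\<Omega>u, \<Omega>d). \<Omega>d $ i $ j,
              \<lambda>(\<Omega>u, \<Omega>d). dagger \<Omega>u $ i $ j, \<lambda>(\<Omega>u, \<Omega>d). dagger \<Omega>d $ i $ j})"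

datatype sector = Up | Down

fun X_mat :: "cmat3 \<times> cmat3 \<Rightarrow> sector \<Rightarrow> cmat3" where
  "X_mat (\<Omega>u, \<Omega>d) Up = \<Omega>u ** dagger \<Omega>u"
| "X_mat (\<Omega>u, \<Omega>d) Down = \<Omega>d ** dagger \<Omega>d"

definition X_word :: "cmat3 \<times> cmat3 \<Rightarrow> sector list \<Rightarrow> cmat3" where
  "X_word \<Omega> w = foldr (\<lambda>f M. X_mat \<Omega> f ** M) w (mat 1)"

definition word_traces :: "(cmat3 \<times> cmat3 \<Rightarrow> complex) set" where
  "word_traces = range (\<lambda>w \<Omega>. trace (X_word \<Omega> w))"

text \<open>The conjugates have to be included: for instance \<open>det \<Omega>\<^sub>u * cnj (det \<Omega>\<^sub>d)\<close> is invariant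
  under \<open>SG_F\<close>, whereas \<open>det \<Omega>\<^sub>u\<close> alone is not, because \<open>G\<^sub>Q\<close> still ranges over all of \<open>U3\<close>.\<close>

definition sector_dets :: "(cmat3 \<times> cmat3 \<Rightarrow> complex) set" where
  "sector_dets =
     {\<lambda>(\<Omega>u, \<Omega>d). det \<Omega>u, \<lambda>(\<Omega>u, \<Omega>d). cnj (det \<Omega>u),
      \<lambda>(\<Omega>u, \<Omega>d). det \<Omega>d, \<lambda>(\<Omega>u, \<Omega>d). cnj (det \<Omega>d)}"


text \<open>\<open>same_up_to_right_frames \<Omega> \<Omega>'\<close>: singular value decompositions of the two pairs can be
  chosen that differ at most in the right frames \<open>W\<^sub>u\<close>, \<open>W\<^sub>d\<close>.\<close>

fun same_up_to_right_frames :: "cmat3 \<times> cmat3 \<Rightarrow> cmat3 \<times> cmat3 \<Rightarrow> bool" where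
  "same_up_to_right_frames (\<Omega>u, \<Omega>d) (\<Omega>u', \<Omega>d') \<longleftrightarrow>
     (\<exists>Uu Du Wu Wu' Ud Dd Wd Wd'.
        is_svd \<Omega>u Uu Du Wu \<and> is_svd \<Omega>u' Uu Du Wu' \<and>
        is_svd \<Omega>d Ud Dd Wd \<and> is_svd \<Omega>d' Ud Dd Wd')"

definition right_frame_independent :: "(cmat3 \<times> cmat3 \<Rightarrow> complex) \<Rightarrow> bool" where
  "right_frame_independent p \<longleftrightarrow>
     (\<forall>\<Omega> \<Omega>'. same_up_to_right_frames \<Omega> \<Omega>' \<longrightarrow> p \<Omega> = p \<Omega>')"

definition right_frame_independent_mod_dets :: "(cmat3 \<times> cmat3 \<Rightarrow> complex) \<Rightarrow> bool" where
  "right_frame_independent_mod_dets p \<longleftrightarrow>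
     (\<forall>\<Omega>u \<Omega>d \<Omega>u' \<Omega>d'. same_up_to_right_frames (\<Omega>u, \<Omega>d) (\<Omega>u', \<Omega>d') \<and>
        det \<Omega>u = det \<Omega>u' \<and> det \<Omega>d = det \<Omega>d' \<longrightarrow> p (\<Omega>u, \<Omega>d) = p (\<Omega>u', \<Omega>d'))"

end

(* For each sector, the action on a square matrix and its adjoint, treated as independent
   variables A and B, reads f (A G) B = f A (G B) once G-dagger is moved to the other side.  This is
   a polynomial identity in G, so it passes from the unitary group to all matrices, and G = A gives
   f A B = f 1 (A B).  Under SU(3) one first splits f by the phase weights of the two sectors; a
   component of weight 3k picks up det A ^ k, and invariance under the scalars of U(3)_Q forces the
   two weights to be opposite.  What remains is a function q of the X matrices that is invariant under
   conjugation.  Orthogonal projection makes its coefficient tensor commute with every G tensored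
   with itself k times, hence, after polarisation, with every symmetrised matrix; a double commutant
   argument makes it a combination of permutations, and contracting a permutation with the X matrices
   yields one trace of a word per cycle. *)

theory Submission
  imports Defs
begin

subsection \<open>Polynomial functions\<close>

text \<open>Two density facts carry the argument. Pairs consisting of a matrix and its adjoint form
  a real form of the space of independent pairs, so a polynomial identity on them holds for
  unrelated matrices too. And U(3) is Zariski dense in all 3 by 3 matrices, because diagonal and
  circulant matrices lie on polynomial curves that are unitary at infinitely many parameters, and
  these generate the elementary matrices. Every covariance is written without inverses,
  \<open>A ** G\<close> against \<open>G ** B\<close>, and conjugation invariance as
  \<open>q (G Y) = q (Y G)\<close>. The choice \<open>G = A\<close> must be legitimate for singular
  \<open>A\<close>, where inverses do not exist. For the same reason the determinant of a sector of
  negative weight is extracted from the adjoint variable: only nonnegative powers then appear. No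
  averaging over the group and no complete reducibility enters. Their place is taken by positivity:
  a coordinate vector that pairs to zero with its own conjugate vanishes. This yields the projection
  of coefficients, their equivariance, and the expansion of the identity that drives the double
  commutant step.\<close>

lemma polys_in_comp:
  assumes "f \<in> polys_in S" and "\<And>s. s \<in> S \<Longrightarrow> (\<lambda>x. s (\<phi> x)) \<in> polys_in S'"
  shows "(\<lambda>x. f (\<phi> x)) \<in> polys_in S'"
  using assms(1) by induction (auto intro: polys_in.intros assms(2))

lemma polys_in_sum:
  assumes "\<And>i. i \<in> I \<Longrightarrow> f i \<in> polys_in S"
  shows "(\<lambda>x. \<Sum>i\<in>I. f i x) \<in> polys_in S"
  using assms
  by (induction I rule: infinite_finite_induct) (auto intro: polys_in.intros)

lemma polys_in_prod:
  assumes "\<And>i. i \<in> I \<Longrightarrow> f i \<in> polys_in S"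
  shows "(\<lambda>x. \<Prod>i\<in>I. f i x) \<in> polys_in S"
  using assms
  by (induction I rule: infinite_finite_induct) (auto intro: polys_in.intros)

lemma polys_in_power: "f \<in> polys_in S \<Longrightarrow> (\<lambda>x. f x ^ k) \<in> polys_in S"
  by (induction k) (auto intro: polys_in.intros)

lemma polys_in_diff:
  assumes "f \<in> polys_in S" "g \<in> polys_in S"
  shows "(\<lambda>x. f x - g x) \<in> polys_in S"
proof -
  have "(\<lambda>x. f x + (-1) * g x) \<in> polys_in S"
    by (intro polys_in.intros assms)
  thus ?thesis by simp
qed

lemma polys_in_mono: "f \<in> polys_in S \<Longrightarrow> S \<subseteq> S' \<Longrightarrow> f \<in> polys_in S'"
  using polys_in_comp[of f S "\<lambda>x. x" S'] by (auto intro: polys_in.gen)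

lemma polys_in_matrix_mult:
  fixes A B :: "'a \<Rightarrow> complex^'n^'n"
  assumes "\<And>i j. (\<lambda>x. A x $ i $ j) \<in> polys_in S" "\<And>i j. (\<lambda>x. B x $ i $ j) \<in> polys_in S"
  shows "(\<lambda>x. (A x ** B x) $ i $ j) \<in> polys_in S"
  unfolding matrix_matrix_mult_def by (simp, intro polys_in_sum polys_in.mult assms)

lemma polys_in_det:
  fixes A :: "'a \<Rightarrow> complex^'n^'n"
  assumes "\<And>i j. (\<lambda>x. A x $ i $ j) \<in> polys_in S"
  shows "(\<lambda>x. det (A x)) \<in> polys_in S"
  unfolding det_def by (intro polys_in_sum polys_in.mult polys_in_prod assms polys_in.const)

lemmas polys_in_intros = polys_in.const polys_in.add polys_in.mult polys_in_sum polys_in_prod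
  polys_in_power polys_in_diff polys_in_matrix_mult polys_in_det

lemma polys_in_univariate:
  assumes "f \<in> polys_in {\<lambda>t. t}"
  shows "\<exists>p. \<forall>t. f t = poly p t"
  using assms
proof induction
  case (const c)
  show ?case by (rule exI[of _ "[:c:]"]) simp
next
  case (gen f)
  thus ?case by (intro exI[of _ "[:0, 1:]"]) simp
next
  case (add f g)
  then obtain p q where "\<forall>t. f t = poly p t" "\<forall>t. g t = poly q t" by blast
  thus ?case by (intro exI[of _ "p + q"]) simp
next
  case (mult f g)
  then obtain p q where "\<forall>t. f t = poly p t" "\<forall>t. g t = poly q t" by blast
  thus ?case by (intro exI[of _ "p * q"]) simp
qed

lemma polys_in_univariate_eq_0:
  assumes "f \<in> polys_in {\<lambda>t. t}" "infinite T" "\<And>t. t \<in> T \<Longrightarrow> f t = 0"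
  shows "f z = 0"
proof -
  obtain p where p: "\<And>t. f t = poly p t"
    using polys_in_univariate[OF assms(1)] by blast
  have "T \<subseteq> {t. poly p t = 0}" using assms(3) p by auto
  hence "p = 0" using poly_roots_finite assms(2) finite_subset by blast
  thus ?thesis using p by simp
qed

definition entries :: "(('s \<Rightarrow> complex^'n^'n) \<Rightarrow> complex) set" where
  "entries = range (\<lambda>(s, i, j) Z. Z s $ i $ j)"

lemma entries_in: "(\<lambda>Z. Z s $ i $ j) \<in> entries"
  unfolding entries_def by (rule image_eqI[of _ _ "(s, i, j)"]) auto

lemma polys_in_entries_comp:
  assumes "f \<in> polys_in entries" "\<And>s i j. (\<lambda>x. \<phi> x s $ i $ j) \<in> polys_in S"
  shows "(\<lambda>x. f (\<phi> x)) \<in> polys_in S"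
  by (rule polys_in_comp[OF assms(1)]) (auto simp: entries_def assms(2))

lemma polys_in_id: "(\<lambda>t. t) \<in> polys_in {\<lambda>t. t}"
  by (auto intro: polys_in.gen)

lemma infinite_complex_Reals: "infinite (\<real> :: complex set)"
  by (metis Reals_def finite_imageD infinite_UNIV_char_0 inj_of_real)

text \<open>A polynomial in \<open>t\<close> that vanishes for real \<open>t\<close> vanishes at \<open>t = \<i>\<close>: this passes from a
  real form to its complexification along a single line.\<close>

lemma entries_vanish_complexification:
  fixes A B :: "'s \<Rightarrow> complex^'n^'n"
  assumes f: "f \<in> polys_in entries"
    and vanish: "\<And>t :: real. f (\<lambda>s. \<chi> i j. A s $ i $ j + of_real t * B s $ i $ j) = 0"
  shows "f (\<lambda>s. \<chi> i j. A s $ i $ j + \<i> * B s $ i $ j) = 0"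
proof (rule polys_in_univariate_eq_0[OF _ infinite_complex_Reals,
      of "\<lambda>t. f (\<lambda>s. \<chi> i j. A s $ i $ j + t * B s $ i $ j)"])
  show "(\<lambda>t. f (\<lambda>s. \<chi> i j. A s $ i $ j + t * B s $ i $ j)) \<in> polys_in {\<lambda>t. t}"
    by (rule polys_in_entries_comp[OF f]) (simp, intro polys_in_intros polys_in_id)
qed (auto simp: Reals_def vanish)

subsection \<open>Separation in finite-dimensional coordinate spaces\<close>

text \<open>Induction on the number of coordinates. If some \<open>v0\<close> in \<open>V\<close> is
  nonzero at the new coordinate \<open>a\<close>, a multiple of \<open>v0\<close> clears
  \<open>w a\<close> and the problem descends to the subspace vanishing at \<open>a\<close>.
  Otherwise the functional reading off coordinate \<open>a\<close> kills \<open>V\<close>, which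
  forces \<open>w a = 0\<close>.\<close>

lemma double_annihilator:
  fixes V :: "('j \<Rightarrow> complex) set"
  assumes "finite J"
    and "\<And>u v. u \<in> V \<Longrightarrow> v \<in> V \<Longrightarrow> (\<lambda>j. u j + v j) \<in> V"
    and "\<And>c v. v \<in> V \<Longrightarrow> (\<lambda>j. c * v j) \<in> V"
    and "(\<lambda>_. 0) \<in> V"
    and "\<And>f. (\<And>v. v \<in> V \<Longrightarrow> (\<Sum>j\<in>J. f j * v j) = 0) \<Longrightarrow> (\<Sum>j\<in>J. f j * w j) = 0"
  shows "\<exists>v\<in>V. \<forall>j\<in>J. v j = w j"
  using assms
proof (induction J arbitrary: V w rule: finite_induct)
  case empty
  thus ?case by auto
next
  case (insert a J)
  note V = insert.prems(1-3) and ann = insert.prems(4)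
  show ?case
  proof (cases "\<exists>v0\<in>V. v0 a \<noteq> 0")
    case True
    then obtain v0 where v0: "v0 \<in> V" "v0 a \<noteq> 0" by blast
    let ?V0 = "{v \<in> V. v a = 0}"
    let ?w0 = "\<lambda>j. w j - w a / v0 a * v0 j"
    have "\<exists>v\<in>?V0. \<forall>j\<in>J. v j = ?w0 j"
    proof (rule insert.IH)
      fix f
      assume f: "\<And>v. v \<in> ?V0 \<Longrightarrow> (\<Sum>j\<in>J. f j * v j) = 0"
      let ?s = "\<Sum>j\<in>J. f j * v0 j"
      \<comment> \<open>This value at \<open>a\<close> makes the extended functional kill
        \<open>v0\<close> too, hence all of \<open>V\<close>.\<close>
      let ?f = "f(a := - ?s / v0 a)"
      have ext: "(\<Sum>j\<in>insert a J. ?f j * v j) = - ?s / v0 a * v a + (\<Sum>j\<in>J. f j * v j)" for v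
      proof -
        have "(\<Sum>j\<in>J. ?f j * v j) = (\<Sum>j\<in>J. f j * v j)"
          using insert.hyps by (intro sum.cong) auto
        thus ?thesis using insert.hyps by simp
      qed
      have "(\<Sum>j\<in>insert a J. ?f j * w j) = 0"
      proof (rule ann)
        fix v assume v: "v \<in> V"
        have "(\<lambda>j. v j + (- v a / v0 a) * v0 j) \<in> ?V0"
          using V(1)[OF v V(2)[OF v0(1), of "- v a / v0 a"]] v0(2) by simp
        from f[OF this] have "(\<Sum>j\<in>J. f j * v j) = v a / v0 a * ?s"
          by (simp add: algebra_simps sum.distrib sum_subtractf sum_distrib_left sum_distrib_right)
        thus "(\<Sum>j\<in>insert a J. ?f j * v j) = 0" unfolding ext by simp
      qed
      thus "(\<Sum>j\<in>J. f j * ?w0 j) = 0" unfolding ext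
        by (simp add: algebra_simps sum_subtractf sum_distrib_left sum_divide_distrib)
    qed (use V in auto)
    then obtain v where v: "v \<in> V" "v a = 0" "\<And>j. j \<in> J \<Longrightarrow> v j = ?w0 j" by blast
    have "(\<lambda>j. v j + w a / v0 a * v0 j) \<in> V" using V v0 v by blast
    moreover have "\<forall>j\<in>insert a J. v j + w a / v0 a * v0 j = w j" using v v0 by simp
    ultimately show ?thesis
      by (intro bexI[of _ "\<lambda>j. v j + w a / v0 a * v0 j"])
  next
    case False
    have restr: "(\<Sum>j\<in>insert a J. (if j = a then c else f j) * v j) = c * v a + (\<Sum>j\<in>J. f j * v j)"
      for c and f v :: "'j \<Rightarrow> complex"
    proof -
      have "(\<Sum>j\<in>J. (if j = a then c else f j) * v j) = (\<Sum>j\<in>J. f j * v j)"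
        using insert.hyps by (intro sum.cong) auto
      thus ?thesis using insert.hyps by simp
    qed
    have "(\<Sum>j\<in>insert a J. (if j = a then 1 else 0) * w j) = 0"
      using False by (intro ann) (simp add: restr)
    hence wa: "w a = 0" by (simp add: restr)
    have "\<exists>v\<in>V. \<forall>j\<in>J. v j = w j"
    proof (rule insert.IH[OF V])
      fix f assume "\<And>v. v \<in> V \<Longrightarrow> (\<Sum>j\<in>J. f j * v j) = 0"
      hence "(\<Sum>j\<in>insert a J. (if j = a then 0 else f j) * w j) = 0"
        by (intro ann) (simp add: restr)
      thus "(\<Sum>j\<in>J. f j * w j) = 0" by (simp add: restr)
    qed
    thus ?thesis using wa False by auto
  qed
qed

lemma sum_mult_cnj_eq_0:
  assumes "finite J" "(\<Sum>j\<in>J. f j * cnj (f j)) = 0" "j \<in> J"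
  shows "f j = 0"
proof -
  have "of_real (\<Sum>j\<in>J. (cmod (f j))\<^sup>2) = (\<Sum>j\<in>J. f j * cnj (f j))"
    by (simp add: complex_norm_square[symmetric])
  hence "(\<Sum>j\<in>J. (cmod (f j))\<^sup>2) = 0" using assms(2) by (metis of_real_eq_0_iff)
  thus ?thesis using assms by (simp add: sum_nonneg_eq_0_iff)
qed

text \<open>The pairing is bilinear, not Hermitian, which is why closure under conjugation is asked
  for. A functional killing \<open>V + ?N\<close> kills \<open>V\<close>, so its conjugate kills
  \<open>V\<close> as well and lies in \<open>?N\<close>; it therefore pairs to zero with its own
  conjugate and vanishes on \<open>J\<close>. Thus \<open>V + ?N\<close> exhausts the coordinates in
  \<open>J\<close>, and the \<open>V\<close>-part of \<open>w\<close> represents \<open>w\<close> on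
  \<open>V\<close>.\<close>

lemma projection_onto_cnj_closed:
  fixes V :: "('j \<Rightarrow> complex) set"
  assumes J: "finite J"
    and V: "\<And>u v. u \<in> V \<Longrightarrow> v \<in> V \<Longrightarrow> (\<lambda>j. u j + v j) \<in> V"
      "\<And>c v. v \<in> V \<Longrightarrow> (\<lambda>j. c * v j) \<in> V" "(\<lambda>_. 0) \<in> V"
    and V_cnj: "\<And>v. v \<in> V \<Longrightarrow> (\<lambda>j. cnj (v j)) \<in> V"
  shows "\<exists>u\<in>V. \<forall>v\<in>V. (\<Sum>j\<in>J. w j * v j) = (\<Sum>j\<in>J. u j * v j)"
proof -
  let ?N = "{n. \<forall>v\<in>V. (\<Sum>j\<in>J. n j * v j) = 0}"
  let ?W = "{x. \<exists>u\<in>V. \<exists>n\<in>?N. x = (\<lambda>j. u j + n j)}"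
  have "\<exists>x\<in>?W. \<forall>j\<in>J. x j = w j"
  proof (rule double_annihilator[OF J])
    fix x y assume "x \<in> ?W" "y \<in> ?W"
    then obtain u n u' n' where "u \<in> V" "n \<in> ?N" "x = (\<lambda>j. u j + n j)"
      "u' \<in> V" "n' \<in> ?N" "y = (\<lambda>j. u' j + n' j)" by blast
    thus "(\<lambda>j. x j + y j) \<in> ?W"
      by (intro CollectI bexI[of _ "\<lambda>j. u j + u' j"] bexI[of _ "\<lambda>j. n j + n' j"])
        (auto simp: V algebra_simps sum.distrib)
  next
    fix c x assume "x \<in> ?W"
    then obtain u n where "u \<in> V" "n \<in> ?N" "x = (\<lambda>j. u j + n j)" by blast
    thus "(\<lambda>j. c * x j) \<in> ?W"
      by (intro CollectI bexI[of _ "\<lambda>j. c * u j"] bexI[of _ "\<lambda>j. c * n j"])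
        (auto simp: V algebra_simps simp flip: sum_distrib_left)
  next
    show "(\<lambda>_. 0) \<in> ?W"
      by (intro CollectI bexI[of _ "\<lambda>_. 0"]) (auto simp: V)
  next
    fix f assume f: "\<And>x. x \<in> ?W \<Longrightarrow> (\<Sum>j\<in>J. f j * x j) = 0"
    have ann: "(\<Sum>j\<in>J. f j * v j) = 0" if "v \<in> V" for v
      by (rule f, intro CollectI bexI[of _ v] bexI[of _ "\<lambda>_. 0"]) (auto simp: that)
    have "(\<Sum>j\<in>J. cnj (f j) * v j) = 0" if "v \<in> V" for v
      using arg_cong[OF ann[OF V_cnj[OF that]], of cnj] by simp
    hence "(\<lambda>j. cnj (f j)) \<in> ?W"
      by (intro CollectI bexI[of _ "\<lambda>_. 0"] bexI[of _ "\<lambda>j. cnj (f j)"]) (auto simp: V)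
    from sum_mult_cnj_eq_0[OF J f[OF this]] show "(\<Sum>j\<in>J. f j * w j) = 0" by simp
  qed
  then obtain u n where un: "u \<in> V" "n \<in> ?N" "\<forall>j\<in>J. u j + n j = w j" by blast
  have "(\<Sum>j\<in>J. w j * v j) = (\<Sum>j\<in>J. u j * v j)" if "v \<in> V" for v
  proof -
    have "(\<Sum>j\<in>J. w j * v j) = (\<Sum>j\<in>J. (u j + n j) * v j)"
      using un(3) by (intro sum.cong) auto
    thus ?thesis using un(2) that by (simp add: distrib_right sum.distrib)
  qed
  thus ?thesis using un(1) by blast
qed

text \<open>Every member of a finite family of vectors lies in the range of its frame operator
  \<open>C \<mapsto> (\<Sum>\<sigma>. \<langle>R \<sigma>, C\<rangle> R \<sigma>)\<close>, because a functional that vanishes on the range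
  vanishes on the family.\<close>

lemma frame_operator_range:
  fixes R :: "'p \<Rightarrow> 'j \<Rightarrow> complex"
  assumes J: "finite J" and P: "finite P" "\<tau> \<in> P"
    and real: "\<And>\<sigma> j. cnj (R \<sigma> j) = R \<sigma> j"
  shows "\<exists>C. \<forall>j\<in>J. (\<Sum>\<sigma>\<in>P. (\<Sum>i\<in>J. R \<sigma> i * C i) * R \<sigma> j) = R \<tau> j"
proof -
  let ?F = "\<lambda>C j. \<Sum>\<sigma>\<in>P. (\<Sum>i\<in>J. R \<sigma> i * C i) * R \<sigma> j"
  have "\<exists>v\<in>range ?F. \<forall>j\<in>J. v j = R \<tau> j"
  proof (rule double_annihilator[OF J])
    fix u v assume "u \<in> range ?F" "v \<in> range ?F"
    then obtain C D where "u = ?F C" "v = ?F D" by blast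
    hence "(\<lambda>j. u j + v j) = ?F (\<lambda>i. C i + D i)"
      by (simp add: algebra_simps sum.distrib)
    thus "(\<lambda>j. u j + v j) \<in> range ?F" by (rule range_eqI[of _ ?F])
  next
    fix c v assume "v \<in> range ?F"
    then obtain C where "v = ?F C" by blast
    hence "(\<lambda>j. c * v j) = ?F (\<lambda>i. c * C i)"
      by (simp add: algebra_simps sum_distrib_left)
    thus "(\<lambda>j. c * v j) \<in> range ?F" by (rule range_eqI[of _ ?F])
  next
    have "(\<lambda>_. 0) = ?F (\<lambda>_. 0)" by simp
    thus "(\<lambda>_. 0) \<in> range ?F" by (rule range_eqI[of _ ?F])
  next
    fix f assume f: "\<And>v. v \<in> range ?F \<Longrightarrow> (\<Sum>j\<in>J. f j * v j) = 0"
    let ?r = "\<lambda>\<sigma>. \<Sum>j\<in>J. f j * R \<sigma> j"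
    \<comment> \<open>Testing \<open>f\<close> on the image of its own conjugate gives a sum of
      squared moduli, since \<open>R\<close> is real.\<close>
    have "(\<Sum>j\<in>J. f j * ?F (\<lambda>i. cnj (f i)) j) = (\<Sum>\<sigma>\<in>P. ?r \<sigma> * cnj (?r \<sigma>))"
    proof -
      have "(\<Sum>j\<in>J. f j * ?F (\<lambda>i. cnj (f i)) j)
          = (\<Sum>j\<in>J. \<Sum>\<sigma>\<in>P. f j * R \<sigma> j * cnj (?r \<sigma>))"
        by (simp add: sum_distrib_left real mult_ac)
      also have "\<dots> = (\<Sum>\<sigma>\<in>P. \<Sum>j\<in>J. f j * R \<sigma> j * cnj (?r \<sigma>))" by (rule sum.swap)
      finally show ?thesis by (simp only: sum_distrib_right)
    qed
    hence "(\<Sum>\<sigma>\<in>P. ?r \<sigma> * cnj (?r \<sigma>)) = 0" using f by auto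
    from sum_mult_cnj_eq_0[OF P(1) this P(2)] show "(\<Sum>j\<in>J. f j * R \<tau> j) = 0" .
  qed
  thus ?thesis by blast
qed

subsection \<open>Monomials\<close>

definition list_monomial :: "('s \<times> 'n \<times> 'n) list \<Rightarrow> ('s \<Rightarrow> complex^'n^'n) \<Rightarrow> complex" where
  "list_monomial L Z = (\<Prod>(s, i, j)\<leftarrow>L. Z s $ i $ j)"

lemma list_monomial_append: "list_monomial (L @ L') Z = list_monomial L Z * list_monomial L' Z"
  by (simp add: list_monomial_def)

lemma list_monomial_polys_in: "list_monomial L \<in> polys_in entries"
proof (induction L)
  case Nil
  show ?case by (simp add: list_monomial_def polys_in.const)
next
  case (Cons x L)
  obtain s i j where "x = (s, i, j)" by (cases x)
  thus ?case using polys_in.mult[OF polys_in.gen[OF entries_in[of s i j]] Cons]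
    by (simp add: list_monomial_def)
qed

lemma polys_in_entries_monomials:
  assumes "q \<in> polys_in entries"
  shows "\<exists>xs. \<forall>Z. q Z = (\<Sum>(c, L)\<leftarrow>xs. c * list_monomial L Z)"
  using assms
proof induction
  case (const c)
  show ?case by (rule exI[of _ "[(c, [])]"]) (simp add: list_monomial_def)
next
  case (gen f)
  then obtain s i j where "f = (\<lambda>Z. Z s $ i $ j)" by (auto simp: entries_def)
  thus ?case by (intro exI[of _ "[(1, [(s, i, j)])]"]) (simp add: list_monomial_def)
next
  case (add f g)
  then obtain xs ys where
    "\<And>Z. f Z = (\<Sum>(c, L)\<leftarrow>xs. c * list_monomial L Z)"
    "\<And>Z. g Z = (\<Sum>(c, L)\<leftarrow>ys. c * list_monomial L Z)" by blast
  thus ?case by (intro exI[of _ "xs @ ys"]) simp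
next
  case (mult f g)
  then obtain xs ys where xy:
    "\<And>Z. f Z = (\<Sum>(c, L)\<leftarrow>xs. c * list_monomial L Z)"
    "\<And>Z. g Z = (\<Sum>(c, L)\<leftarrow>ys. c * list_monomial L Z)" by blast
  have single: "(\<Sum>(d, L')\<leftarrow>map (\<lambda>(d, L'). (c * d, L @ L')) ys. d * list_monomial L' Z)
      = c * list_monomial L Z * (\<Sum>(d, L')\<leftarrow>ys. d * list_monomial L' Z)" for c L Z
    by (induction ys) (auto simp: list_monomial_append algebra_simps)
  have "(\<Sum>(c, L)\<leftarrow>concat (map (\<lambda>(c, L). map (\<lambda>(d, L'). (c * d, L @ L')) ys) xs).
        c * list_monomial L Z)
      = (\<Sum>(c, L)\<leftarrow>xs. c * list_monomial L Z) * (\<Sum>(c, L)\<leftarrow>ys. c * list_monomial L Z)" for Z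
    by (induction xs) (auto simp: single distrib_right simp del: map_map)
  thus ?case using xy
    by (intro exI[of _ "concat (map (\<lambda>(c, L). map (\<lambda>(d, L'). (c * d, L @ L')) ys) xs)"]) simp
qed

subsection \<open>Polarisation\<close>

text \<open>Permutations are encoded as surjective self-maps because surjectivity is what the sign
  sum in \<open>polarisation\<close> detects; extensionality keeps the set finite.\<close>

definition perms :: "nat \<Rightarrow> (nat \<Rightarrow> nat) set" where
  "perms k = {\<sigma> \<in> {..<k} \<rightarrow>\<^sub>E {..<k}. {..<k} \<subseteq> \<sigma> ` {..<k}}"

lemma finite_perms: "finite (perms k)"
  by (rule finite_subset[of _ "{..<k} \<rightarrow>\<^sub>E {..<k}"]) (auto simp: perms_def intro: finite_PiE)

lemma perms_less: "\<sigma> \<in> perms k \<Longrightarrow> t < k \<Longrightarrow> \<sigma> t < k"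
  by (auto simp: perms_def)

text \<open>Inclusion-exclusion over 0/1 values extracts the multilinear coefficient: the
  alternating sum annihilates every monomial that misses a variable, so among the maps
  \<open>\<tau>\<close> from expanding the product only the surjective ones survive.\<close>

lemma polarisation:
  fixes h :: "nat \<Rightarrow> nat \<Rightarrow> complex"
  shows "(\<Sum>\<epsilon>\<in>{..<k} \<rightarrow>\<^sub>E {0, 1}. (\<Prod>l<k. if \<epsilon> l = 0 then -1 else 1) *
      (\<Prod>t<k. \<Sum>l<k. \<epsilon> l * h l t)) = (\<Sum>\<sigma>\<in>perms k. \<Prod>t<k. h (\<sigma> t) t)"
proof -
  let ?E = "{..<k} \<rightarrow>\<^sub>E {0, 1 :: complex}" and ?P = "{..<k} \<rightarrow>\<^sub>E {..<k}"
  let ?sg = "\<lambda>e::complex. if e = 0 then -1 else 1 :: complex"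
  have inner: "(\<Sum>\<epsilon>\<in>?E. (\<Prod>l<k. ?sg (\<epsilon> l)) * (\<Prod>t<k. \<epsilon> (\<tau> t)))
      = (if \<tau> \<in> perms k then 1 else 0)" if \<tau>: "\<tau> \<in> ?P" for \<tau>
  proof -
    let ?I = "\<tau> ` {..<k}"
    \<comment> \<open>The values 0 and 1 are idempotent, so repeated factors collapse and only the
      image of \<open>\<tau>\<close> matters.\<close>
    have "(\<Prod>t<k. \<epsilon> (\<tau> t)) = (\<Prod>l<k. if l \<in> ?I then \<epsilon> l else 1)" if "\<epsilon> \<in> ?E" for \<epsilon>
    proof (cases "\<forall>l\<in>?I. \<epsilon> l = 1")
      case True
      hence "(\<Prod>l<k. if l \<in> ?I then \<epsilon> l else 1) = 1" by (intro prod.neutral) auto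
      thus ?thesis using True by simp
    next
      case False
      then obtain t where t: "t < k" "\<epsilon> (\<tau> t) \<noteq> 1" by auto
      moreover have "\<tau> t < k" using \<tau> t by auto
      ultimately have "\<epsilon> (\<tau> t) = 0" using \<open>\<epsilon> \<in> ?E\<close> by auto
      hence "(\<Prod>t<k. \<epsilon> (\<tau> t)) = 0"
        using t by (auto simp: prod_zero_iff)
      moreover have "(\<Prod>l<k. if l \<in> ?I then \<epsilon> l else 1) = 0"
        using t(1) \<open>\<tau> t < k\<close> \<open>\<epsilon> (\<tau> t) = 0\<close> by (auto simp: prod_zero_iff intro!: bexI[of _ "\<tau> t"])
      ultimately show ?thesis by (simp only:)
    qed
    hence "(\<Sum>\<epsilon>\<in>?E. (\<Prod>l<k. ?sg (\<epsilon> l)) * (\<Prod>t<k. \<epsilon> (\<tau> t)))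
        = (\<Sum>\<epsilon>\<in>?E. \<Prod>l<k. ?sg (\<epsilon> l) * (if l \<in> ?I then \<epsilon> l else 1))"
      by (intro sum.cong) (simp_all add: prod.distrib)
    also have "\<dots> = (\<Prod>l<k. \<Sum>e\<in>{0, 1}. ?sg e * (if l \<in> ?I then e else 1))"
      by (subst prod_sum_PiE) auto
    \<comment> \<open>A factor is \<open>0 + 1\<close> on the image of \<open>\<tau>\<close> and
      \<open>-1 + 1\<close> off it.\<close>
    also have "\<dots> = (\<Prod>l<k. if l \<in> ?I then 1 else 0)"
      by (intro prod.cong) auto
    also have "\<dots> = (if {..<k} \<subseteq> ?I then 1 else 0)"
      by (auto simp: prod_zero_iff subset_iff)
    finally show ?thesis using \<tau> by (simp add: perms_def)
  qed
  have "(\<Prod>t<k. \<Sum>l<k. \<epsilon> l * h l t) = (\<Sum>\<tau>\<in>?P. (\<Prod>t<k. \<epsilon> (\<tau> t)) * (\<Prod>t<k. h (\<tau> t) t))" for \<epsilon>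
    by (subst prod_sum_PiE) (auto simp: prod.distrib)
  hence "(\<Sum>\<epsilon>\<in>?E. (\<Prod>l<k. ?sg (\<epsilon> l)) * (\<Prod>t<k. \<Sum>l<k. \<epsilon> l * h l t))
      = (\<Sum>\<epsilon>\<in>?E. \<Sum>\<tau>\<in>?P. (\<Prod>l<k. ?sg (\<epsilon> l)) * (\<Prod>t<k. \<epsilon> (\<tau> t)) * (\<Prod>t<k. h (\<tau> t) t))"
    by (simp add: sum_distrib_left mult_ac)
  also have "\<dots> = (\<Sum>\<tau>\<in>?P. (\<Sum>\<epsilon>\<in>?E. (\<Prod>l<k. ?sg (\<epsilon> l)) * (\<Prod>t<k. \<epsilon> (\<tau> t))) * (\<Prod>t<k. h (\<tau> t) t))"
    by (subst sum.swap) (simp add: sum_distrib_right)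
  also have "\<dots> = (\<Sum>\<tau>\<in>?P. if \<tau> \<in> perms k then \<Prod>t<k. h (\<tau> t) t else 0)"
    by (intro sum.cong) (simp_all add: inner)
  also have "\<dots> = (\<Sum>\<sigma>\<in>perms k. \<Prod>t<k. h (\<sigma> t) t)"
    by (rule sum.mono_neutral_cong_right) (auto simp: perms_def intro: finite_PiE)
  finally show ?thesis .
qed

subsection \<open>Traces of words from permutations\<close>

definition matrix_word :: "('s \<Rightarrow> complex^'n^'n) \<Rightarrow> 's list \<Rightarrow> complex^'n^'n" where
  "matrix_word Z w = foldr (\<lambda>s M. Z s ** M) w (mat 1)"

lemma matrix_word_append: "matrix_word Z (v @ w) = matrix_word Z v ** matrix_word Z w"
  by (induction v) (simp_all add: matrix_word_def matrix_mul_assoc)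

definition trace_words :: "(('s \<Rightarrow> complex^'n^'n) \<Rightarrow> complex) set" where
  "trace_words = range (\<lambda>w Z. trace (matrix_word Z w))"

lemma sum_PiE_insert:
  fixes F :: "('a \<Rightarrow> 'b::finite) \<Rightarrow> 'c::comm_monoid_add"
  assumes "m \<notin> K"
  shows "(\<Sum>a\<in>insert m K \<rightarrow>\<^sub>E UNIV. F a) = (\<Sum>a\<in>K \<rightarrow>\<^sub>E UNIV. \<Sum>y\<in>UNIV. F (a(m := y)))"
proof -
  have "(\<Sum>a\<in>insert m K \<rightarrow>\<^sub>E UNIV. F a) = (\<Sum>(y, a)\<in>UNIV \<times> (K \<rightarrow>\<^sub>E UNIV). F (a(m := y)))"
    unfolding PiE_insert_eq
    by (subst sum.reindex[OF inj_combinator[OF assms]]) (simp add: case_prod_unfold)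
  thus ?thesis by (simp add: sum.cartesian_product[symmetric] sum.swap[of _ _ UNIV])
qed

text \<open>Contracting \<open>y\<close> in \<open>(W p)\<^bsub>a y\<^esub> (W m)\<^bsub>y b\<^esub>\<close> shortens the permutation by one element and
  concatenates two words; a fixed point splits off a trace.\<close>

lemma contraction_polys_in_trace_words:
  fixes W :: "'a \<Rightarrow> 's list"
  assumes "finite K" "inj_on \<sigma> K" "\<sigma> ` K \<subseteq> K"
  shows "(\<lambda>Z :: 's \<Rightarrow> complex^'n^'n. \<Sum>a\<in>K \<rightarrow>\<^sub>E UNIV. \<Prod>l\<in>K. matrix_word Z (W l) $ a l $ a (\<sigma> l))
    \<in> polys_in trace_words"
  using assms
proof (induction K arbitrary: \<sigma> W rule: finite_induct)
  case empty
  show ?case by (simp add: polys_in.const)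
next
  case (insert m K)
  let ?M = "\<lambda>Z l. matrix_word Z (W l) :: complex^'n^'n"
  have surj: "\<sigma> ` insert m K = insert m K"
    using endo_inj_surj insert.hyps insert.prems by (metis finite_insert)
  show ?case
  proof (cases "\<sigma> m = m")
    case True
    have K: "\<sigma> l \<in> K" if "l \<in> K" for l
    proof -
      have "\<sigma> l \<noteq> \<sigma> m" using that insert.prems(1) insert.hyps(2) by (auto simp: inj_on_def)
      thus ?thesis using that insert.prems(2) True by auto
    qed
    have "(\<Sum>a\<in>insert m K \<rightarrow>\<^sub>E UNIV. \<Prod>l\<in>insert m K. ?M Z l $ a l $ a (\<sigma> l))
        = (\<Sum>a\<in>K \<rightarrow>\<^sub>E UNIV. \<Prod>l\<in>K. ?M Z l $ a l $ a (\<sigma> l)) * trace (?M Z m)" for Z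
    proof -
      have "(\<Sum>a\<in>insert m K \<rightarrow>\<^sub>E UNIV. \<Prod>l\<in>insert m K. ?M Z l $ a l $ a (\<sigma> l))
        = (\<Sum>a\<in>K \<rightarrow>\<^sub>E UNIV. \<Sum>y\<in>UNIV. ?M Z m $ y $ y * (\<Prod>l\<in>K. ?M Z l $ a l $ a (\<sigma> l)))"
        unfolding sum_PiE_insert[OF insert.hyps(2)]
      proof (intro sum.cong refl)
        fix a :: "'a \<Rightarrow> 'n" and y
        have "(\<Prod>l\<in>K. ?M Z l $ (a(m := y)) l $ (a(m := y)) (\<sigma> l)) = (\<Prod>l\<in>K. ?M Z l $ a l $ a (\<sigma> l))"
          using K insert.hyps by (intro prod.cong) auto
        thus "(\<Prod>l\<in>insert m K. ?M Z l $ (a(m := y)) l $ (a(m := y)) (\<sigma> l))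
            = ?M Z m $ y $ y * (\<Prod>l\<in>K. ?M Z l $ a l $ a (\<sigma> l))"
          using insert.hyps True by simp
      qed
      thus ?thesis by (simp add: trace_def sum_distrib_left sum_distrib_right mult.commute)
    qed
    moreover have "(\<lambda>Z. trace (?M Z m)) \<in> trace_words" by (auto simp: trace_words_def)
    moreover have "inj_on \<sigma> K" "\<sigma> ` K \<subseteq> K" using insert.prems K by (auto intro: inj_on_subset)
    ultimately show ?thesis by (simp add: insert.IH polys_in.mult polys_in.gen)
  next
    case False
    have "m \<in> \<sigma> ` insert m K" using surj by simp
    with False obtain p where p: "p \<in> K" "\<sigma> p = m" by auto
    let ?\<sigma> = "\<sigma>(p := \<sigma> m)" and ?W = "W(p := W p @ W m)"
    have m: "\<sigma> m \<in> K" using False insert.prems by auto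
    have K: "\<sigma> l \<in> K" if "l \<in> K" "l \<noteq> p" for l
    proof -
      have "\<sigma> l \<noteq> \<sigma> p" using that insert.prems(1) p(1) by (auto simp: inj_on_def)
      thus ?thesis using that insert.prems(2) p(2) by auto
    qed
    have "(\<Sum>a\<in>insert m K \<rightarrow>\<^sub>E UNIV. \<Prod>l\<in>insert m K. ?M Z l $ a l $ a (\<sigma> l))
        = (\<Sum>a\<in>K \<rightarrow>\<^sub>E UNIV. \<Prod>l\<in>K. matrix_word Z (?W l) $ a l $ a (?\<sigma> l))" for Z
    proof -
      have "(\<Sum>a\<in>insert m K \<rightarrow>\<^sub>E UNIV. \<Prod>l\<in>insert m K. ?M Z l $ a l $ a (\<sigma> l))
        = (\<Sum>a\<in>K \<rightarrow>\<^sub>E UNIV. \<Sum>y\<in>UNIV. ?M Z p $ a p $ y * ?M Z m $ y $ a (\<sigma> m) *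
            (\<Prod>l\<in>K - {p}. ?M Z l $ a l $ a (\<sigma> l)))"
        unfolding sum_PiE_insert[OF insert.hyps(2)]
      proof (intro sum.cong refl)
        fix a :: "'a \<Rightarrow> 'n" and y
        have eq: "(\<Prod>l\<in>K - {p}. ?M Z l $ (a(m := y)) l $ (a(m := y)) (\<sigma> l))
            = (\<Prod>l\<in>K - {p}. ?M Z l $ a l $ a (\<sigma> l))"
          using K insert.hyps by (intro prod.cong) auto
        have ne: "p \<noteq> m" using p(1) insert.hyps(2) by blast
        show "(\<Prod>l\<in>insert m K. ?M Z l $ (a(m := y)) l $ (a(m := y)) (\<sigma> l))
            = ?M Z p $ a p $ y * ?M Z m $ y $ a (\<sigma> m) * (\<Prod>l\<in>K - {p}. ?M Z l $ a l $ a (\<sigma> l))"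
          unfolding prod.insert[OF insert.hyps(1,2)] prod.remove[OF insert.hyps(1) p(1)] eq
          using p(2) ne False by (simp add: mult_ac)
      qed
      also have "\<dots> = (\<Sum>a\<in>K \<rightarrow>\<^sub>E UNIV. \<Prod>l\<in>K. matrix_word Z (?W l) $ a l $ a (?\<sigma> l))"
      proof (intro sum.cong refl)
        fix a :: "'a \<Rightarrow> 'n"
        have "(\<Prod>l\<in>K - {p}. matrix_word Z (?W l) $ a l $ a (?\<sigma> l))
            = (\<Prod>l\<in>K - {p}. ?M Z l $ a l $ a (\<sigma> l))" by (intro prod.cong) auto
        thus "(\<Sum>y\<in>UNIV. ?M Z p $ a p $ y * ?M Z m $ y $ a (\<sigma> m) * (\<Prod>l\<in>K - {p}. ?M Z l $ a l $ a (\<sigma> l)))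
            = (\<Prod>l\<in>K. matrix_word Z (?W l) $ a l $ a (?\<sigma> l))"
          unfolding prod.remove[OF insert.hyps(1) p(1)]
          by (simp add: matrix_word_append matrix_matrix_mult_def sum_distrib_right)
      qed
      finally show ?thesis .
    qed
    moreover have "?\<sigma> ` K \<subseteq> K" using K m by auto
    \<comment> \<open>Only \<open>m\<close> was sent to \<open>\<sigma> m\<close>, so with
      \<open>m\<close> removed this value is free for \<open>p\<close>.\<close>
    moreover have "inj_on ?\<sigma> K"
    proof (rule inj_onI)
      fix x y assume "x \<in> K" "y \<in> K" "?\<sigma> x = ?\<sigma> y"
      thus "x = y" using insert.prems(1) insert.hyps(2)
        by (auto simp: inj_on_def split: if_splits)
    qed
    ultimately show ?thesis by (simp only: insert.IH)
  qed
qed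

subsection \<open>The first fundamental theorem for matrix invariants\<close>

definition index_tuples :: "nat \<Rightarrow> (nat \<Rightarrow> 'n) set" where
  "index_tuples k = {..<k} \<rightarrow>\<^sub>E UNIV"

lemma finite_index_tuples: "finite (index_tuples k :: (nat \<Rightarrow> 'n::finite) set)"
  by (simp add: index_tuples_def finite_PiE)

lemma prod_sum_index_tuples:
  fixes f :: "nat \<Rightarrow> 'n::finite \<Rightarrow> 'c::comm_semiring_1"
  shows "(\<Prod>l<k. \<Sum>y\<in>UNIV. f l y) = (\<Sum>i\<in>index_tuples k. \<Prod>l<k. f l (i l))"
  unfolding index_tuples_def by (rule prod_sum_PiE) auto

text \<open>Row and column indices are separate tuples, so that multiplying all variables from the
  left acts on \<open>i\<close> alone and from the right on \<open>j\<close> alone. By commutativity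
  one monomial has several names, hence coefficients are not unique.\<close>

fun word_monomial :: "'s list \<times> (nat \<Rightarrow> 'n::finite) \<times> (nat \<Rightarrow> 'n) \<Rightarrow> ('s \<Rightarrow> complex^'n^'n) \<Rightarrow> complex" where
  "word_monomial (w, i, j) Z = (\<Prod>l<length w. Z (w ! l) $ i l $ j l)"

lemma word_monomial_left:
  "word_monomial (w, i, j) (\<lambda>s. G ** Z s) =
     (\<Sum>i'\<in>index_tuples (length w). (\<Prod>l<length w. G $ i l $ i' l) * word_monomial (w, i', j) Z)"
  by (simp add: matrix_matrix_mult_def prod_sum_index_tuples prod.distrib)

lemma word_monomial_right:
  "word_monomial (w, i, j) (\<lambda>s. Z s ** G) =
     (\<Sum>j'\<in>index_tuples (length w). word_monomial (w, i, j') Z * (\<Prod>l<length w. G $ j' l $ j l))"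
  by (simp add: matrix_matrix_mult_def prod_sum_index_tuples prod.distrib)

lemma list_monomial_word_monomial:
  "\<exists>i\<in>index_tuples (length L). \<exists>j\<in>index_tuples (length L).
     \<forall>Z. list_monomial L Z = word_monomial (map fst L, i, j) Z"
proof (intro bexI allI)
  fix Z
  let ?i = "restrict (\<lambda>l. fst (snd (L ! l))) {..<length L}"
  let ?j = "restrict (\<lambda>l. snd (snd (L ! l))) {..<length L}"
  show "list_monomial L Z = word_monomial (map fst L, ?i, ?j) Z"
    unfolding list_monomial_def
    by (auto simp: prod.list_conv_set_nth case_prod_unfold atLeast0LessThan intro!: prod.cong)
qed (auto simp: index_tuples_def)

definition monomials :: "'s list set \<Rightarrow> ('s list \<times> (nat \<Rightarrow> 'n) \<times> (nat \<Rightarrow> 'n)) set" where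
  "monomials D = (SIGMA w:D. index_tuples (length w) \<times> index_tuples (length w))"

lemma finite_monomials: "finite D \<Longrightarrow> finite (monomials D :: ('s list \<times> (nat \<Rightarrow> 'n::finite) \<times> _) set)"
  by (auto simp: monomials_def finite_index_tuples)

lemma sum_monomials:
  fixes F :: "'s list \<times> (nat \<Rightarrow> 'n::finite) \<times> (nat \<Rightarrow> 'n) \<Rightarrow> 'c::comm_monoid_add"
  assumes "finite D"
  shows "(\<Sum>x\<in>monomials D. F x) =
     (\<Sum>w\<in>D. \<Sum>i\<in>index_tuples (length w). \<Sum>j\<in>index_tuples (length w). F (w, i, j))"
  using assms by (simp add: monomials_def sum.Sigma finite_index_tuples case_prod_unfold
      sum.cartesian_product)

text \<open>All index tuples over the words in \<open>D\<close> are included, with zero coefficients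
  where necessary, so that the index set suits \<open>left_action\<close> and
  \<open>right_action\<close>, which mix the tuples of a fixed word.\<close>

lemma polys_in_entries_word_monomials:
  assumes "q \<in> polys_in (entries :: (('s \<Rightarrow> complex^'n^'n) \<Rightarrow> complex) set)"
  shows "\<exists>D T. finite D \<and> (\<forall>Z. q Z = (\<Sum>x\<in>monomials D. T x * word_monomial x Z))"
proof -
  obtain xs where xs: "\<And>Z. q Z = (\<Sum>(c, L)\<leftarrow>xs. c * list_monomial L Z)"
    using polys_in_entries_monomials[OF assms] by blast
  have "\<exists>D T. finite D \<and>
      (\<forall>Z :: 's \<Rightarrow> complex^'n^'n. (\<Sum>(c, L)\<leftarrow>xs. c * list_monomial L Z)
         = (\<Sum>x\<in>monomials D. T x * word_monomial x Z))"
  proof (induction xs)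
    case Nil
    show ?case by (intro exI[of _ "{}"]) (simp add: monomials_def)
  next
    case (Cons y xs)
    then obtain D and T :: "'s list \<times> (nat \<Rightarrow> 'n) \<times> (nat \<Rightarrow> 'n) \<Rightarrow> complex" where D: "finite D"
      and T: "\<And>Z :: 's \<Rightarrow> complex^'n^'n. (\<Sum>(c, L)\<leftarrow>xs. c * list_monomial L Z)
         = (\<Sum>x\<in>monomials D. T x * word_monomial x Z)" by blast
    obtain c L where y: "y = (c, L)" by (cases y)
    obtain i j where ij: "i \<in> index_tuples (length L)" "j \<in> index_tuples (length L)"
      and L: "\<And>Z :: 's \<Rightarrow> complex^'n^'n. list_monomial L Z = word_monomial (map fst L, i, j) Z"
      using list_monomial_word_monomial by metis
    let ?x = "(map fst L, i, j)" and ?D = "insert (map fst L) D"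
    \<comment> \<open>\<open>T\<close> is unconstrained outside \<open>monomials D\<close> and must
      be cut off before the index set grows.\<close>
    let ?T = "\<lambda>x. (if x \<in> monomials D then T x else 0) + (if x = ?x then c else 0)"
    have fin: "finite (monomials ?D :: ('s list \<times> (nat \<Rightarrow> 'n) \<times> _) set)"
      using D by (simp add: finite_monomials)
    have sub: "monomials D \<subseteq> (monomials ?D :: ('s list \<times> (nat \<Rightarrow> 'n) \<times> _) set)" and mem: "?x \<in> monomials ?D"
      using ij by (auto simp: monomials_def)
    have "(\<Sum>(c, L)\<leftarrow>y # xs. c * list_monomial L Z) = (\<Sum>x\<in>monomials ?D. ?T x * word_monomial x Z)"
      for Z :: "'s \<Rightarrow> complex^'n^'n"
    proof -
      have "(\<Sum>x\<in>monomials ?D. ?T x * word_monomial x Z)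
          = (\<Sum>x\<in>monomials ?D. if x \<in> monomials D then T x * word_monomial x Z else 0)
            + (\<Sum>x\<in>monomials ?D. if x = ?x then c * word_monomial ?x Z else 0)"
        unfolding sum.distrib[symmetric] by (intro sum.cong) (auto simp: distrib_right)
      also have "(\<Sum>x\<in>monomials ?D. if x \<in> monomials D then T x * word_monomial x Z else 0)
          = (\<Sum>x\<in>monomials D. T x * word_monomial x Z)"
        using fin sub by (simp add: sum.inter_restrict[symmetric] Int_absorb1)
      also have "(\<Sum>x\<in>monomials ?D. if x = ?x then c * word_monomial ?x Z else 0)
          = c * word_monomial ?x Z"
        using fin mem by simp
      finally show ?thesis by (simp add: y L T del: word_monomial.simps)
    qed
    thus ?case using D by (intro exI[of _ ?D] exI[of _ ?T]) simp
  qed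
  thus ?thesis using xs by simp
qed

text \<open>The linear span of the evaluation vectors \<open>\<lambda>x. word_monomial x Z\<close>.
  Coefficients influence a polynomial only through their pairing with these vectors.\<close>

inductive_set monomial_span :: "('s list \<times> (nat \<Rightarrow> 'n::finite) \<times> (nat \<Rightarrow> 'n) \<Rightarrow> complex) set" where
  zero: "(\<lambda>_. 0) \<in> monomial_span"
| add: "v \<in> monomial_span \<Longrightarrow> (\<lambda>x. c * word_monomial x Z + v x) \<in> monomial_span"

lemma monomial_span_add:
  assumes "u \<in> monomial_span" "v \<in> monomial_span"
  shows "(\<lambda>x. u x + v x) \<in> monomial_span"
  using assms
proof induction
  case (add u c Z)
  thus ?case using monomial_span.add[of "\<lambda>x. u x + v x" c Z] by (simp add: add.assoc)
qed simp

lemma monomial_span_scale: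
  assumes "v \<in> monomial_span"
  shows "(\<lambda>x. a * v x) \<in> monomial_span"
  using assms
proof induction
  case (add v c Z)
  thus ?case using monomial_span.add[of "\<lambda>x. a * v x" "a * c" Z] by (simp add: algebra_simps)
qed (simp add: monomial_span.zero)

text \<open>A monomial has real coefficients, so conjugating its value amounts to conjugating the
  point of evaluation.\<close>

lemma monomial_span_cnj:
  fixes v :: "'s list \<times> (nat \<Rightarrow> 'n::finite) \<times> (nat \<Rightarrow> 'n) \<Rightarrow> complex"
  assumes "v \<in> monomial_span"
  shows "(\<lambda>x. cnj (v x)) \<in> monomial_span"
  using assms
proof induction
  case (add v c Z)
  have "cnj (word_monomial x Z) = word_monomial x (\<lambda>s. \<chi> i j. cnj (Z s $ i $ j))" for x
    by (cases x) simp
  thus ?case using monomial_span.add[OF add.IH, of "cnj c" "\<lambda>s. \<chi> i j. cnj (Z s $ i $ j)"] by simp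
qed (simp add: monomial_span.zero)

text \<open>The transpose, for the pairing of coefficients with monomials, of the substitution
  \<open>Z s \<mapsto> G ** Z s\<close>; \<open>right_action\<close> is the transpose of
  \<open>Z s \<mapsto> Z s ** G\<close>.\<close>

definition left_action ::
  "complex^'n^'n \<Rightarrow> ('s list \<times> (nat \<Rightarrow> 'n::finite) \<times> (nat \<Rightarrow> 'n) \<Rightarrow> complex) \<Rightarrow> _" where
  "left_action G v = (\<lambda>(w, i', j). \<Sum>i\<in>index_tuples (length w). (\<Prod>l<length w. G $ i l $ i' l) * v (w, i, j))"

definition right_action ::
  "complex^'n^'n \<Rightarrow> ('s list \<times> (nat \<Rightarrow> 'n::finite) \<times> (nat \<Rightarrow> 'n) \<Rightarrow> complex) \<Rightarrow> _" where
  "right_action G v = (\<lambda>(w, i, j). \<Sum>j'\<in>index_tuples (length w). (\<Prod>l<length w. G $ j l $ j' l) * v (w, i, j'))"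

lemma left_action_word_monomial:
  "left_action G (\<lambda>x. word_monomial x Z) x = word_monomial x (\<lambda>s. transpose G ** Z s)"
proof (cases x)
  case (fields w i j)
  thus ?thesis unfolding fields word_monomial_left left_action_def by (simp add: transpose_def)
qed

lemma right_action_word_monomial:
  "right_action G (\<lambda>x. word_monomial x Z) x = word_monomial x (\<lambda>s. Z s ** transpose G)"
proof (cases x)
  case (fields w i j)
  thus ?thesis unfolding fields word_monomial_right right_action_def
    by (simp add: transpose_def mult.commute)
qed

text \<open>Both actions send an evaluation vector to another one, at
  \<open>transpose G ** Z s\<close> and at \<open>Z s ** transpose G\<close> respectively.\<close>

lemma monomial_span_actions:
  assumes "v \<in> monomial_span"
  shows "left_action G v \<in> monomial_span" "right_action G v \<in> monomial_span"
proof -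
  have left: "left_action G (\<lambda>x. c * word_monomial x Z + v x)
      = (\<lambda>x. c * word_monomial x (\<lambda>s. transpose G ** Z s) + left_action G v x)" for c Z and v
    unfolding left_action_word_monomial[symmetric]
    by (auto simp: left_action_def fun_eq_iff algebra_simps sum.distrib sum_distrib_left)
  show "left_action G v \<in> monomial_span"
    using assms
  proof induction
    case zero
    show ?case using monomial_span.zero by (simp add: left_action_def case_prod_unfold)
  next
    case (add v c Z)
    show ?case unfolding left by (rule monomial_span.add[OF add.IH])
  qed
  have right: "right_action G (\<lambda>x. c * word_monomial x Z + v x)
      = (\<lambda>x. c * word_monomial x (\<lambda>s. Z s ** transpose G) + right_action G v x)" for c Z and v
    unfolding right_action_word_monomial[symmetric]
    by (auto simp: right_action_def fun_eq_iff algebra_simps sum.distrib sum_distrib_left)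
  show "right_action G v \<in> monomial_span"
    using assms
  proof induction
    case zero
    show ?case using monomial_span.zero by (simp add: right_action_def case_prod_unfold)
  next
    case (add v c Z)
    show ?case unfolding right by (rule monomial_span.add[OF add.IH])
  qed
qed

lemma sum_swap_outer:
  "(\<Sum>i\<in>I. \<Sum>j\<in>J. \<Sum>k\<in>K. f i j k) = (\<Sum>k\<in>K. \<Sum>j\<in>J. \<Sum>i\<in>I. f i j k)"
proof -
  have "(\<Sum>i\<in>I. \<Sum>j\<in>J. \<Sum>k\<in>K. f i j k) = (\<Sum>j\<in>J. \<Sum>i\<in>I. \<Sum>k\<in>K. f i j k)" by (rule sum.swap)
  also have "\<dots> = (\<Sum>j\<in>J. \<Sum>k\<in>K. \<Sum>i\<in>I. f i j k)" by (intro sum.cong refl sum.swap)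
  also have "\<dots> = (\<Sum>k\<in>K. \<Sum>j\<in>J. \<Sum>i\<in>I. f i j k)" by (rule sum.swap)
  finally show ?thesis .
qed

lemma sum_word_monomial_left:
  assumes "finite D"
  shows "(\<Sum>x\<in>monomials D. u x * word_monomial x (\<lambda>s. G ** Y s))
    = (\<Sum>x\<in>monomials D. left_action G u x * word_monomial x Y)"
  unfolding sum_monomials[OF assms] word_monomial_left left_action_def sum_distrib_left
    sum_distrib_right prod.case
  by (rule sum.cong[OF refl], rule trans[OF sum_swap_outer]) (intro sum.cong refl, simp add: mult_ac)

lemma sum_word_monomial_right:
  assumes "finite D"
  shows "(\<Sum>x\<in>monomials D. u x * word_monomial x (\<lambda>s. Y s ** G))
    = (\<Sum>x\<in>monomials D. right_action G u x * word_monomial x Y)"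
  unfolding sum_monomials[OF assms] word_monomial_right right_action_def sum_distrib_left
    sum_distrib_right prod.case
  by (rule sum.cong[OF refl], rule sum.cong[OF refl], rule trans[OF sum.swap])
    (intro sum.cong refl, simp add: mult_ac)

text \<open>Replacing the coefficient tensor by its orthogonal projection onto the span of the
  evaluation vectors makes it unique, and hence equivariant; this takes the place of averaging
  over the group.\<close>

lemma equivariant_coefficients:
  fixes q :: "('s \<Rightarrow> complex^'n^'n) \<Rightarrow> complex"
  assumes q: "q \<in> polys_in entries"
    and inv: "\<And>G Y. q (\<lambda>s. G ** Y s) = q (\<lambda>s. Y s ** G)"
  shows "\<exists>D u. finite D \<and> (\<forall>Z. q Z = (\<Sum>x\<in>monomials D. u x * word_monomial x Z)) \<and>
    (\<forall>G. \<forall>x\<in>monomials D. left_action G u x = right_action G u x)"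
proof -
  obtain D and T :: "'s list \<times> (nat \<Rightarrow> 'n) \<times> (nat \<Rightarrow> 'n) \<Rightarrow> complex" where D: "finite D"
    and T: "\<And>Z. q Z = (\<Sum>x\<in>monomials D. T x * word_monomial x Z)"
    using polys_in_entries_word_monomials[OF q] by blast
  have J: "finite (monomials D :: ('s list \<times> (nat \<Rightarrow> 'n) \<times> _) set)"
    using D by (rule finite_monomials)
  obtain u where u: "u \<in> monomial_span"
    and uT: "\<And>v. v \<in> monomial_span \<Longrightarrow> (\<Sum>x\<in>monomials D. T x * v x) = (\<Sum>x\<in>monomials D. u x * v x)"
    using projection_onto_cnj_closed[OF J monomial_span_add monomial_span_scale
        monomial_span.zero monomial_span_cnj] by blast
  have qu: "q Z = (\<Sum>x\<in>monomials D. u x * word_monomial x Z)" for Z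
    using uT[OF monomial_span.add[OF monomial_span.zero, of 1 Z]] T by simp
  have "left_action G u x = right_action G u x" if x: "x \<in> monomials D" for G x
  proof -
    \<comment> \<open>The difference lies in the span, and by invariance it annihilates the span.
      The conjugate of the difference is in the span too, so positivity makes it vanish on
      \<open>monomials D\<close>.\<close>
    let ?d = "\<lambda>x. left_action G u x + (-1) * right_action G u x"
    have d: "?d \<in> monomial_span"
      by (intro monomial_span_add monomial_span_scale monomial_span_actions u)
    have zero: "(\<Sum>x\<in>monomials D. ?d x * word_monomial x Y) = 0" for Y
      using inv[of G Y] unfolding qu sum_word_monomial_left[OF D] sum_word_monomial_right[OF D]
      by (simp add: algebra_simps sum_subtractf)
    have "(\<Sum>x\<in>monomials D. ?d x * v x) = 0" if "v \<in> monomial_span" for v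
      using that
    proof induction
      case (add v c Z)
      have "(\<Sum>x\<in>monomials D. ?d x * (c * word_monomial x Z + v x))
          = c * (\<Sum>x\<in>monomials D. ?d x * word_monomial x Z) + (\<Sum>x\<in>monomials D. ?d x * v x)"
        unfolding sum_distrib_left sum.distrib[symmetric]
        by (intro sum.cong refl) (simp add: algebra_simps)
      thus ?case using zero add.IH by simp
    qed simp
    from sum_mult_cnj_eq_0[OF J this[OF monomial_span_cnj[OF d]] x] show ?thesis by simp
  qed
  thus ?thesis using D qu by blast
qed

section \<open>Operators permuting tensor factors, and Schur-Weyl duality\<close>

definition perm_delta :: "nat \<Rightarrow> (nat \<Rightarrow> nat) \<Rightarrow> (nat \<Rightarrow> 'n) \<Rightarrow> (nat \<Rightarrow> 'n) \<Rightarrow> complex" where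
  "perm_delta k \<sigma> i a = (if \<forall>l<k. i l = a (\<sigma> l) then 1 else 0)"

lemma sum_index_tuples_delta:
  fixes a :: "nat \<Rightarrow> 'n::finite"
  assumes "\<And>i j. (\<And>l. l < k \<Longrightarrow> i l = j l) \<Longrightarrow> F i = F j"
  shows "(\<Sum>i\<in>index_tuples k. perm_delta k \<sigma> i a * F i) = F (\<lambda>l. a (\<sigma> l))"
proof -
  let ?a = "restrict (\<lambda>l. a (\<sigma> l)) {..<k}"
  have "(\<Sum>i\<in>index_tuples k. perm_delta k \<sigma> i a * F i) = (\<Sum>i\<in>index_tuples k. if i = ?a then F ?a else 0)"
  proof (intro sum.cong refl)
    fix i :: "nat \<Rightarrow> 'n" assume "i \<in> index_tuples k"
    hence "(\<forall>l<k. i l = a (\<sigma> l)) \<longleftrightarrow> i = ?a"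
      by (auto simp: index_tuples_def fun_eq_iff PiE_def extensional_def)
    thus "perm_delta k \<sigma> i a * F i = (if i = ?a then F ?a else 0)"
      by (simp add: perm_delta_def)
  qed
  also have "\<dots> = F ?a" by (simp add: finite_index_tuples) (simp add: index_tuples_def)
  also have "\<dots> = F (\<lambda>l. a (\<sigma> l))" by (rule assms) simp
  finally show ?thesis .
qed

text \<open>The coefficient of \<open>\<epsilon>\<^sub>0 \<cdots> \<epsilon>\<^bsub>k-1\<^esub>\<close> in the hypothesis at
  \<open>G = (\<Sum>l. \<epsilon>\<^sub>l E\<^bsub>a l, b l\<^esub>)\<close>.\<close>

lemma polarised_commutation:
  fixes t :: "(nat \<Rightarrow> 'n::finite) \<Rightarrow> (nat \<Rightarrow> 'n) \<Rightarrow> complex"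
  assumes comm: "\<And>G :: complex^'n^'n. (\<Sum>i\<in>index_tuples k. (\<Prod>l<k. G $ i l $ i' l) * t i j)
      = (\<Sum>j'\<in>index_tuples k. (\<Prod>l<k. G $ j l $ j' l) * t i' j')"
  shows "(\<Sum>\<sigma>\<in>perms k. \<Sum>i\<in>index_tuples k. perm_delta k \<sigma> i a * perm_delta k \<sigma> i' b * t i j)
    = (\<Sum>\<sigma>\<in>perms k. \<Sum>j'\<in>index_tuples k. perm_delta k \<sigma> j a * perm_delta k \<sigma> j' b * t i' j')"
proof -
  let ?E = "{..<k} \<rightarrow>\<^sub>E {0, 1 :: complex}"
  let ?sg = "\<lambda>\<epsilon> :: nat \<Rightarrow> complex. \<Prod>l<k. if \<epsilon> l = 0 then -1 else 1 :: complex"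
  let ?G = "\<lambda>\<epsilon> :: nat \<Rightarrow> complex. \<chi> p q. \<Sum>l<k. \<epsilon> l * (if p = a l \<and> q = b l then 1 else 0)"
  have *: "(\<Sum>\<epsilon>\<in>?E. ?sg \<epsilon> * (\<Sum>i\<in>index_tuples k. (\<Prod>l<k. ?G \<epsilon> $ f i l $ g i l) * s i))
     = (\<Sum>\<sigma>\<in>perms k. \<Sum>i\<in>index_tuples k. perm_delta k \<sigma> (f i) a * perm_delta k \<sigma> (g i) b * s i)"
    for f g :: "(nat \<Rightarrow> 'n) \<Rightarrow> nat \<Rightarrow> 'n" and s
  proof -
    have delta: "(\<Prod>l<k. if i l = a (\<sigma> l) \<and> i' l = b (\<sigma> l) then 1 else 0)
        = perm_delta k \<sigma> i a * perm_delta k \<sigma> i' b" for \<sigma> i i'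
      by (auto simp: perm_delta_def prod_zero_iff)
    have "(\<Sum>\<epsilon>\<in>?E. ?sg \<epsilon> * (\<Sum>i\<in>index_tuples k. (\<Prod>l<k. ?G \<epsilon> $ f i l $ g i l) * s i))
        = (\<Sum>i\<in>index_tuples k. (\<Sum>\<epsilon>\<in>?E. ?sg \<epsilon> *
           (\<Prod>l<k. \<Sum>m<k. \<epsilon> m * (if f i l = a m \<and> g i l = b m then 1 else 0))) * s i)"
      unfolding sum_distrib_left sum_distrib_right vec_lambda_beta
      by (subst sum.swap) (intro sum.cong refl, simp only: mult_ac)
    also have "\<dots> = (\<Sum>i\<in>index_tuples k. (\<Sum>\<sigma>\<in>perms k.
        perm_delta k \<sigma> (f i) a * perm_delta k \<sigma> (g i) b) * s i)"
      unfolding polarisation delta ..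
    also have "\<dots> = (\<Sum>\<sigma>\<in>perms k. \<Sum>i\<in>index_tuples k.
        perm_delta k \<sigma> (f i) a * perm_delta k \<sigma> (g i) b * s i)"
      unfolding sum_distrib_right by (rule sum.swap)
    finally show ?thesis .
  qed
  show ?thesis
    using *[of "\<lambda>i. i" "\<lambda>_. i'" "\<lambda>i. t i j"] *[of "\<lambda>_. j" "\<lambda>j'. j'" "t i'"]
    by (simp only: comm)
qed

lemma id_perms: "restrict (\<lambda>l. l) {..<k} \<in> perms k"
  by (auto simp: perms_def)

text \<open>The identity tensor is a contraction, with some \<open>C\<close>, of symmetrised matrix
  units \<open>(\<Sum>\<sigma>. perm_delta k \<sigma> i a * perm_delta k \<sigma> i' b)\<close>.
  Inserting it in front of \<open>t\<close> and commuting each unit past \<open>t\<close> leaves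
  \<open>a\<close> and \<open>j\<close> only inside \<open>perm_delta k \<sigma> j a\<close>. The
  permutation operators may be linearly dependent, so \<open>c\<close> is not unique.\<close>

theorem schur_weyl:
  fixes t :: "(nat \<Rightarrow> 'n::finite) \<Rightarrow> (nat \<Rightarrow> 'n) \<Rightarrow> complex"
  assumes comm: "\<And>(G :: complex^'n^'n) i' j. i' \<in> index_tuples k \<Longrightarrow> j \<in> index_tuples k \<Longrightarrow>
      (\<Sum>i\<in>index_tuples k. (\<Prod>l<k. G $ i l $ i' l) * t i j)
      = (\<Sum>j'\<in>index_tuples k. (\<Prod>l<k. G $ j l $ j' l) * t i' j')"
  shows "\<exists>c. \<forall>i\<in>index_tuples k. \<forall>j\<in>index_tuples k.
      t i j = (\<Sum>\<sigma>\<in>perms k. c \<sigma> * perm_delta k \<sigma> j i)"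
proof -
  let ?I = "index_tuples k :: (nat \<Rightarrow> 'n) set" and ?J = "index_tuples k \<times> index_tuples k :: ((nat \<Rightarrow> 'n) \<times> _) set"
  let ?id = "restrict (\<lambda>l. l) {..<k}"
  \<comment> \<open>The identity is itself a permutation operator, so it lies in the range of the
    frame operator of all of them.\<close>
  obtain C where C: "\<And>i a. i \<in> ?I \<Longrightarrow> a \<in> ?I \<Longrightarrow>
      (\<Sum>\<sigma>\<in>perms k. (\<Sum>(i', b)\<in>?J. perm_delta k \<sigma> i' b * C (i', b)) * perm_delta k \<sigma> i a)
        = perm_delta k ?id i a"
    using frame_operator_range[of ?J "perms k" ?id "\<lambda>\<sigma> (i, a). perm_delta k \<sigma> i a"]
    by (auto simp: finite_index_tuples finite_perms id_perms case_prod_unfold perm_delta_def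
        if_distrib cong: if_cong)
  let ?c = "\<lambda>\<sigma>. \<Sum>(i', b)\<in>?J. C (i', b) * (\<Sum>j'\<in>?I. perm_delta k \<sigma> j' b * t i' j')"
  have "t a j = (\<Sum>\<sigma>\<in>perms k. ?c \<sigma> * perm_delta k \<sigma> j a)" if a: "a \<in> ?I" and j: "j \<in> ?I" for a j
  proof -
    have "t a j = (\<Sum>i\<in>?I. if i = a then t a j else 0)" using a by (simp add: finite_index_tuples)
    also have "\<dots> = (\<Sum>i\<in>?I. perm_delta k ?id i a * t i j)"
    proof (intro sum.cong refl)
      fix i assume "i \<in> ?I"
      with a have "(\<forall>l<k. i l = a l) \<longleftrightarrow> i = a"
        by (auto simp: index_tuples_def intro: PiE_ext)
      thus "(if i = a then t a j else 0) = perm_delta k ?id i a * t i j"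
        by (simp add: perm_delta_def)
    qed
    also have "\<dots> = (\<Sum>i\<in>?I. \<Sum>\<sigma>\<in>perms k. \<Sum>(i', b)\<in>?J.
        C (i', b) * (perm_delta k \<sigma> i a * perm_delta k \<sigma> i' b * t i j))"
      using a by (intro sum.cong refl)
        (simp add: C[symmetric] sum_distrib_right sum_distrib_left case_prod_unfold mult_ac)
    also have "\<dots> = (\<Sum>(i', b)\<in>?J. \<Sum>\<sigma>\<in>perms k. \<Sum>i\<in>?I.
        C (i', b) * (perm_delta k \<sigma> i a * perm_delta k \<sigma> i' b * t i j))"
      unfolding case_prod_unfold by (rule sum_swap_outer)
    also have "\<dots> = (\<Sum>(i', b)\<in>?J. C (i', b) * (\<Sum>\<sigma>\<in>perms k. \<Sum>i\<in>?I.
        perm_delta k \<sigma> i a * perm_delta k \<sigma> i' b * t i j))"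
      by (simp add: sum_distrib_left)
    \<comment> \<open>The symmetrised unit moves from the row index of \<open>t\<close> to its
      column index.\<close>
    also have "\<dots> = (\<Sum>(i', b)\<in>?J. C (i', b) * (\<Sum>\<sigma>\<in>perms k. \<Sum>j'\<in>?I.
        perm_delta k \<sigma> j a * perm_delta k \<sigma> j' b * t i' j'))"
      by (intro sum.cong refl) (auto simp: polarised_commutation[OF comm] j)
    also have "\<dots> = (\<Sum>x\<in>?J. \<Sum>\<sigma>\<in>perms k. C x * (\<Sum>j'\<in>?I.
        perm_delta k \<sigma> j' (snd x) * t (fst x) j') * perm_delta k \<sigma> j a)"
      by (simp add: case_prod_unfold sum_distrib_left sum_distrib_right mult_ac)
    also have "\<dots> = (\<Sum>\<sigma>\<in>perms k. ?c \<sigma> * perm_delta k \<sigma> j a)"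
      by (subst sum.swap) (simp add: case_prod_unfold sum_distrib_right)
    finally show ?thesis .
  qed
  thus ?thesis by (intro exI[of _ ?c]) blast
qed

lemma perms_inj_on: "\<sigma> \<in> perms k \<Longrightarrow> inj_on \<sigma> {..<k}"
  by (rule finite_surj_inj) (auto simp: perms_def)

text \<open>The two actions preserve the word \<open>w\<close>, so Schur-Weyl applies to each word
  separately. The deltas then set column \<open>l\<close> equal to row \<open>\<sigma> l\<close>,
  which is the contraction pattern already evaluated cycle by cycle.\<close>

theorem conjugation_invariant_polys_in_trace_words:
  fixes q :: "('s \<Rightarrow> complex^'n^'n) \<Rightarrow> complex"
  assumes q: "q \<in> polys_in entries"
    and inv: "\<And>G Y. q (\<lambda>s. G ** Y s) = q (\<lambda>s. Y s ** G)"
  shows "q \<in> polys_in trace_words"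
proof -
  obtain D and u :: "'s list \<times> (nat \<Rightarrow> 'n) \<times> (nat \<Rightarrow> 'n) \<Rightarrow> complex" where D: "finite D"
    and qu: "\<And>Z. q Z = (\<Sum>x\<in>monomials D. u x * word_monomial x Z)"
    and equiv: "\<And>G x. x \<in> monomials D \<Longrightarrow> left_action G u x = right_action G u x"
    using equivariant_coefficients[OF q inv] by blast
  have "\<exists>c. \<forall>i\<in>index_tuples (length w). \<forall>j\<in>index_tuples (length w).
      u (w, i, j) = (\<Sum>\<sigma>\<in>perms (length w). c \<sigma> * perm_delta (length w) \<sigma> j i)" if "w \<in> D" for w
  proof (rule schur_weyl)
    fix G :: "complex^'n^'n" and i' j :: "nat \<Rightarrow> 'n"
    assume "i' \<in> index_tuples (length w)" "j \<in> index_tuples (length w)"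
    hence "(w, i', j) \<in> monomials D" using that by (simp add: monomials_def)
    from equiv[OF this, of G]
    show "(\<Sum>i\<in>index_tuples (length w). (\<Prod>l<length w. G $ i l $ i' l) * u (w, i, j))
        = (\<Sum>j'\<in>index_tuples (length w). (\<Prod>l<length w. G $ j l $ j' l) * u (w, i', j'))"
      by (simp add: left_action_def right_action_def)
  qed
  hence "\<forall>w\<in>D. \<exists>c. \<forall>i\<in>index_tuples (length w). \<forall>j\<in>index_tuples (length w).
      u (w, i, j) = (\<Sum>\<sigma>\<in>perms (length w). c \<sigma> * perm_delta (length w) \<sigma> j i)" ..
  from bchoice[OF this] obtain c where c: "\<forall>w\<in>D. \<forall>i\<in>index_tuples (length w).
      \<forall>j\<in>index_tuples (length w).
      u (w, i, j) = (\<Sum>\<sigma>\<in>perms (length w). c w \<sigma> * perm_delta (length w) \<sigma> j i)" ..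
  have "q Z = (\<Sum>w\<in>D. \<Sum>\<sigma>\<in>perms (length w). c w \<sigma> *
      (\<Sum>i\<in>{..<length w} \<rightarrow>\<^sub>E UNIV. \<Prod>l<length w. matrix_word Z [w ! l] $ i l $ i (\<sigma> l)))" for Z
    unfolding qu sum_monomials[OF D]
  proof (intro sum.cong refl)
    fix w assume w: "w \<in> D"
    let ?k = "length w"
    let ?I = "index_tuples ?k :: (nat \<Rightarrow> 'n) set"
    have "(\<Sum>i\<in>?I. \<Sum>j\<in>?I. u (w, i, j) * word_monomial (w, i, j) Z)
        = (\<Sum>i\<in>?I. \<Sum>j\<in>?I. \<Sum>\<sigma>\<in>perms ?k. c w \<sigma> * (perm_delta ?k \<sigma> j i * word_monomial (w, i, j) Z))"
      by (intro sum.cong refl) (simp add: c w sum_distrib_right mult.assoc del: word_monomial.simps)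
    also have "\<dots> = (\<Sum>\<sigma>\<in>perms ?k. \<Sum>j\<in>?I. \<Sum>i\<in>?I. c w \<sigma> * (perm_delta ?k \<sigma> j i * word_monomial (w, i, j) Z))"
      by (rule sum_swap_outer)
    also have "\<dots> = (\<Sum>\<sigma>\<in>perms ?k. c w \<sigma> * (\<Sum>i\<in>?I. \<Sum>j\<in>?I. perm_delta ?k \<sigma> j i * word_monomial (w, i, j) Z))"
      unfolding sum_distrib_left by (intro sum.cong refl sum.swap)
    also have "\<dots> = (\<Sum>\<sigma>\<in>perms ?k. c w \<sigma> * (\<Sum>i\<in>?I. word_monomial (w, i, \<lambda>l. i (\<sigma> l)) Z))"
      by (subst sum_index_tuples_delta) auto
    finally show "(\<Sum>i\<in>?I. \<Sum>j\<in>?I. u (w, i, j) * word_monomial (w, i, j) Z)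
        = (\<Sum>\<sigma>\<in>perms ?k. c w \<sigma> *
          (\<Sum>i\<in>{..<?k} \<rightarrow>\<^sub>E UNIV. \<Prod>l<?k. matrix_word Z [w ! l] $ i l $ i (\<sigma> l)))"
      by (simp add: index_tuples_def matrix_word_def)
  qed
  hence "q = (\<lambda>Z. \<Sum>w\<in>D. \<Sum>\<sigma>\<in>perms (length w). c w \<sigma> *
      (\<Sum>i\<in>{..<length w} \<rightarrow>\<^sub>E UNIV. \<Prod>l<length w. matrix_word Z [w ! l] $ i l $ i (\<sigma> l)))"
    by (rule ext)
  also have "\<dots> \<in> polys_in trace_words"
    by (rule polys_in_sum, rule polys_in_sum, rule polys_in.mult, rule polys_in.const,
        rule contraction_polys_in_trace_words) (auto simp: perms_inj_on perms_less)
  finally show ?thesis .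
qed

subsection \<open>Zariski density of the unitary group\<close>

lemma dagger_nth [simp]: "dagger A $ i $ j = cnj (A $ j $ i)"
  by (simp add: dagger_def)

lemma dagger_dagger [simp]: "dagger (dagger A) = A"
  by (simp add: vec_eq_iff)

lemma dagger_mult: "dagger (A ** B) = dagger B ** dagger A"
  by (simp add: vec_eq_iff matrix_matrix_mult_def mult.commute)

lemma dagger_mat_1 [simp]: "dagger (mat 1) = mat 1"
  by (simp add: vec_eq_iff mat_def)

lemma det_dagger: "det (dagger A) = cnj (det A)"
  by (simp add: det_3)

lemma U3_mult: "G \<in> U3 \<Longrightarrow> H \<in> U3 \<Longrightarrow> G ** H \<in> U3"
  by (simp add: U3_def dagger_mult) (metis matrix_mul_assoc matrix_mul_lid)

lemma U3_dagger: "G \<in> U3 \<Longrightarrow> dagger G \<in> U3"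
  by (simp add: U3_def)

lemma U3_mat_1: "mat 1 \<in> U3"
  by (simp add: U3_def)

lemma U3_inverse:
  assumes "G \<in> U3"
  shows "G ** dagger G = mat 1" "dagger G ** G = mat 1"
  using assms by (auto simp: U3_def)

section \<open>Zariski closure of a set of matrices\<close>

definition coordinates :: "(cmat3 \<Rightarrow> complex) set" where
  "coordinates = range (\<lambda>(i, j) A. A $ i $ j)"

lemma polys_in_coordinates_comp:
  assumes "f \<in> polys_in coordinates" "\<And>i j. (\<lambda>x. \<phi> x $ i $ j) \<in> polys_in S"
  shows "(\<lambda>x. f (\<phi> x)) \<in> polys_in S"
  by (rule polys_in_comp[OF assms(1)]) (auto simp: coordinates_def assms(2))

lemma polys_in_coordinate: "(\<lambda>A. A $ i $ j) \<in> polys_in coordinates"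
  unfolding coordinates_def
  by (rule polys_in.gen, rule image_eqI[of _ _ "(i, j)"]) auto

definition zariski_closure :: "cmat3 set \<Rightarrow> cmat3 set" where
  "zariski_closure X =
     {A. \<forall>f\<in>polys_in coordinates. (\<forall>G\<in>X. f G = 0) \<longrightarrow> f A = 0}"

lemma zariski_closure_superset: "X \<subseteq> zariski_closure X"
  by (auto simp: zariski_closure_def)

lemma zariski_closureD:
  "A \<in> zariski_closure X \<Longrightarrow> f \<in> polys_in coordinates \<Longrightarrow> (\<And>G. G \<in> X \<Longrightarrow> f G = 0) \<Longrightarrow> f A = 0"
  by (auto simp: zariski_closure_def)

text \<open>One factor is released at a time: with the right factor in \<open>X\<close> the left one
  may run through the closure, and then the right one follows.\<close>

lemma zariski_closure_mult:
  assumes X: "\<And>G H. G \<in> X \<Longrightarrow> H \<in> X \<Longrightarrow> G ** H \<in> X"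
    and A: "A \<in> zariski_closure X" and B: "B \<in> zariski_closure X"
  shows "A ** B \<in> zariski_closure X"
  unfolding zariski_closure_def
proof (intro CollectI ballI impI)
  fix f assume f: "f \<in> polys_in coordinates" "\<forall>G\<in>X. f G = 0"
  have "f (A ** H) = 0" if "H \<in> X" for H
  proof -
    have "(\<lambda>M. f (M ** H)) \<in> polys_in coordinates"
      by (rule polys_in_coordinates_comp[OF f(1)]) (intro polys_in_intros polys_in_coordinate)
    from zariski_closureD[OF A this] show ?thesis using f(2) X that by simp
  qed
  moreover have "(\<lambda>M. f (A ** M)) \<in> polys_in coordinates"
    by (rule polys_in_coordinates_comp[OF f(1)]) (intro polys_in_intros polys_in_coordinate)
  ultimately show "f (A ** B) = 0" using zariski_closureD[OF B, of "\<lambda>M. f (A ** M)"] by simp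
qed

text \<open>A polynomial vanishing on \<open>X\<close> restricts to a univariate polynomial with
  infinitely many roots along the curve.\<close>

lemma zariski_closure_curve:
  assumes "\<And>i j. (\<lambda>t. \<phi> t $ i $ j) \<in> polys_in {\<lambda>t. t}"
    and "infinite T" "\<And>t. t \<in> T \<Longrightarrow> \<phi> t \<in> zariski_closure X"
  shows "\<phi> z \<in> zariski_closure X"
  unfolding zariski_closure_def
proof (intro CollectI ballI impI)
  fix f assume f: "f \<in> polys_in coordinates" "\<forall>G\<in>X. f G = 0"
  have "(\<lambda>t. f (\<phi> t)) \<in> polys_in {\<lambda>t. t}"
    by (rule polys_in_coordinates_comp[OF f(1) assms(1)])
  from polys_in_univariate_eq_0[OF this assms(2)] show "f (\<phi> z) = 0"
    using zariski_closureD[OF assms(3) f(1)] f(2) by simp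
qed

abbreviation unit_circle :: "complex set" where
  "unit_circle \<equiv> {z. cmod z = 1}"

lemma infinite_unit_circle: "infinite unit_circle"
proof -
  have "inj_on cis {0..pi}"
    by (metis inj_onI atLeastAtMost_iff cis.sel(1) arccos_cos)
  hence "infinite (cis ` {0..pi})"
    using finite_imageD infinite_Icc[OF pi_gt_zero] by blast
  thus ?thesis by (rule infinite_super[rotated]) auto
qed

lemma cmod_1_mult_cnj: "cmod z = 1 \<Longrightarrow> z * cnj z = 1"
  by (simp add: complex_norm_square[symmetric])

section \<open>Diagonal, circulant and elementary matrices in the closure of U(3)\<close>

definition diag3 :: "(3 \<Rightarrow> complex) \<Rightarrow> cmat3" where
  "diag3 d = (\<chi> i j. if i = j then d i else 0)"

lemma diag3_mult_nth:
  "(diag3 d ** A) $ i $ j = d i * A $ i $ j" "(A ** diag3 d) $ i $ j = A $ i $ j * d j"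
  by (simp_all add: diag3_def matrix_matrix_mult_def if_distrib if_distribR cong: if_cong)

lemma diag3_U3: "(\<And>i. cmod (d i) = 1) \<Longrightarrow> diag3 d \<in> U3"
  by (auto simp: U3_def diag3_def vec_eq_iff matrix_matrix_mult_def mat_def forall_3 sum_3
      cmod_1_mult_cnj mult.commute[of "cnj _"])

text \<open>Diagonal entries are released from the unit circle one by one; \<open>S\<close> holds
  the positions already free.\<close>

lemma diag3_zariski_closure_U3: "diag3 d \<in> zariski_closure U3"
proof -
  have "\<forall>d. (\<forall>i. i \<notin> S \<longrightarrow> cmod (d i) = 1) \<longrightarrow> diag3 d \<in> zariski_closure U3" if "finite S" for S
    using that
  proof (induction S rule: finite_induct)
    case empty
    thus ?case using diag3_U3 zariski_closure_superset by blast
  next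
    case (insert m S)
    show ?case
    proof (intro allI impI)
      fix d :: "3 \<Rightarrow> complex" assume d: "\<forall>i. i \<notin> insert m S \<longrightarrow> cmod (d i) = 1"
      have "diag3 (d(m := d m)) \<in> zariski_closure U3"
      proof (rule zariski_closure_curve[OF _ infinite_unit_circle, of "\<lambda>t. diag3 (d(m := t))"])
        fix i j
        show "(\<lambda>t. diag3 (d(m := t)) $ i $ j) \<in> polys_in {\<lambda>t. t}"
          by (cases "i = j"; cases "i = m") (simp_all add: diag3_def polys_in_id polys_in.const)
      qed (use d insert.IH in auto)
      thus "diag3 d \<in> zariski_closure U3" by simp
    qed
  qed
  from this[of UNIV] show ?thesis by simp
qed

lemma polys_in_if: "f \<in> polys_in S \<Longrightarrow> g \<in> polys_in S \<Longrightarrow> (\<lambda>x. if b then f x else g x) \<in> polys_in S"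
  by (cases b) auto

definition circulant2 :: "3 \<Rightarrow> 3 \<Rightarrow> complex \<Rightarrow> complex \<Rightarrow> cmat3" where
  "circulant2 m n a b = (\<chi> i j. if i = j then (if i = m \<or> i = n then a else 1)
     else if i = m \<and> j = n \<or> i = n \<and> j = m then b else 0)"

lemma circulant2_nth:
  "circulant2 m n a b $ i $ j = (if i = j then (if i = m \<or> i = n then a else 1)
     else if i = m \<and> j = n \<or> i = n \<and> j = m then b else 0)"
  by (simp add: circulant2_def)

lemma circulant2_mult_nth:
  assumes "m \<noteq> n"
  shows "(circulant2 m n a b ** A) $ i $ j = (if i = m then a * A $ m $ j + b * A $ n $ j
     else if i = n then b * A $ m $ j + a * A $ n $ j else A $ i $ j)"
proof -
  have "(circulant2 m n a b ** A) $ i $ j =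
      (\<Sum>k\<in>UNIV. (if k = i then circulant2 m n a b $ i $ i * A $ i $ j else 0)
        + (if k = n then (if i = m then b * A $ n $ j else 0) else 0)
        + (if k = m then (if i = n then b * A $ m $ j else 0) else 0))"
    unfolding matrix_matrix_mult_def vec_lambda_beta using assms
    by (intro sum.cong) (auto simp: circulant2_nth)
  thus ?thesis using assms by (auto simp: sum.distrib circulant2_nth)
qed

text \<open>The \<open>2 \<times> 2\<close> circulants are simultaneously diagonalised by a fixed unitary matrix, with
  eigenvalues \<open>z = a + b\<close> and \<open>w = a - b\<close>.\<close>

lemma circulant2_U3:
  assumes "m \<noteq> n" "cmod z = 1" "cmod w = 1"
  shows "circulant2 m n ((z + w) / 2) ((z - w) / 2) \<in> U3"
proof -
  have zw: "z * cnj z = 1" "w * cnj w = 1" using assms cmod_1_mult_cnj by auto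
  have *: "(z + w) / 2 * (cnj z + cnj w) / 2 + (z - w) / 2 * (cnj z - cnj w) / 2 = 1"
    "(z + w) / 2 * (cnj z - cnj w) / 2 + (z - w) / 2 * (cnj z + cnj w) / 2 = 0"
    using zw by (simp_all add: field_simps)
  have "(m = 1 \<or> m = 2 \<or> m = 3) \<and> (n = 1 \<or> n = 2 \<or> n = 3)" using exhaust_3 by blast
  thus ?thesis using assms(1) *
    by (elim conjE disjE)
      (simp_all add: U3_def circulant2_def vec_eq_iff matrix_matrix_mult_def mat_def forall_3 sum_3
        algebra_simps)
qed

text \<open>The eigenvalues \<open>z\<close> and \<open>w\<close> are released from the unit circle
  in turn, and \<open>z = a + b\<close>, \<open>w = a - b\<close> reach every pair \<open>a\<close>,
  \<open>b\<close>.\<close>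

lemma circulant2_zariski_closure_U3:
  assumes "m \<noteq> n"
  shows "circulant2 m n a b \<in> zariski_closure U3"
proof -
  let ?C = "\<lambda>z w. circulant2 m n ((z + w) / 2) ((z - w) / 2)"
  have poly: "(\<lambda>t. circulant2 m n (f t) (g t) $ i $ j) \<in> polys_in {\<lambda>t. t}"
    if "f \<in> polys_in {\<lambda>t. t}" "g \<in> polys_in {\<lambda>t. t}" for f g i j
    using that by (auto simp: circulant2_def polys_in.const intro!: polys_in_if)
  have half: "(\<lambda>t. f t / 2) \<in> polys_in {\<lambda>t. t}" if "f \<in> polys_in {\<lambda>t. t}" for f :: "complex \<Rightarrow> complex"
    using polys_in.mult[OF polys_in.const[of "1/2"] that] by simp
  have *: "?C z w \<in> zariski_closure U3" if "cmod w = 1" for z w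
    by (rule zariski_closure_curve[OF poly infinite_unit_circle, of "\<lambda>z. (z + w) / 2" "\<lambda>z. (z - w) / 2"])
      (intro half polys_in_intros polys_in_id | use circulant2_U3[OF assms] that zariski_closure_superset in blast)+
  have "?C z w \<in> zariski_closure U3" for z w
    by (rule zariski_closure_curve[OF poly infinite_unit_circle, of "\<lambda>w. (z + w) / 2" "\<lambda>w. (z - w) / 2"])
      (intro half polys_in_intros polys_in_id | use * in blast)+
  from this[of "a + b" "a - b"] show ?thesis by simp
qed

lemma transvection_zariski_closure_U3:
  assumes "m \<noteq> n"
  shows "(\<chi> i j. if i = m \<and> j = n then c else of_bool (i = j)) \<in> zariski_closure U3" (is "?E \<in> _")
proof (cases "c = 0")
  case True
  hence "?E = diag3 (\<lambda>_. 1)" using assms by (auto simp: diag3_def vec_eq_iff)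
  thus ?thesis using diag3_zariski_closure_U3 by simp
next
  case False
  \<comment> \<open>The inner diagonal \<open>1/2\<close> makes the product of circulants
    triangular, since \<open>2 * 1 + 1 * (1/2) * (-4) = 0\<close>; its block has rows
    \<open>(-3, -3)\<close> and \<open>(0, -15/2)\<close>. The outer diagonals rescale this to
    \<open>(1, c)\<close> and \<open>(0, 1)\<close>.\<close>
  have "?E = diag3 ((\<lambda>_. 1)(n := 2 / (5 * c))) ** (circulant2 m n 1 2 **
      (diag3 ((\<lambda>_. 1)(n := 1/2)) ** circulant2 m n 1 (-4))) ** diag3 ((\<lambda>_. 1)(m := -1/3, n := -c/3))"
    using assms False
    by (auto simp: diag3_mult_nth circulant2_mult_nth[OF assms] circulant2_nth vec_eq_iff)
  thus ?thesis
    by (simp add: zariski_closure_mult U3_mult diag3_zariski_closure_U3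
        circulant2_zariski_closure_U3[OF assms])
qed

definition complex_matrix :: "real^3^3 \<Rightarrow> cmat3" where
  "complex_matrix A = (\<chi> i j. of_real (A $ i $ j))"

text \<open>Reduction to elementary matrices. The determinant hypothesis passes to factors and rules
  out a zero row; singular matrices are recovered afterwards by a density argument.\<close>

lemma complex_matrix_zariski_closure_U3:
  assumes "det (complex_matrix A) \<noteq> 0"
  shows "complex_matrix A \<in> zariski_closure U3"
proof -
  have "det (complex_matrix A) \<noteq> 0 \<longrightarrow> complex_matrix A \<in> zariski_closure U3"
  proof (induction A rule: induct_matrix_elementary)
    case (1 A B)
    have "complex_matrix (A ** B) = complex_matrix A ** complex_matrix B"
      by (simp add: complex_matrix_def vec_eq_iff matrix_matrix_mult_def)
    thus ?case using 1 by (auto simp: det_mul intro: zariski_closure_mult U3_mult)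
  next
    case (2 A i)
    have "row i (complex_matrix A) = 0"
      using 2 by (simp add: row_def complex_matrix_def vec_eq_iff)
    thus ?case by (simp add: det_zero_row)
  next
    case (3 A)
    hence "complex_matrix A = diag3 (\<lambda>i. of_real (A $ i $ i))"
      by (auto simp: complex_matrix_def diag3_def vec_eq_iff)
    thus ?case by (simp add: diag3_zariski_closure_U3)
  next
    case (4 m n)
    have "complex_matrix (\<chi> i j. mat 1 $ i $ Transposition.transpose m n j) = circulant2 m n 0 1"
      using 4 by (auto simp: complex_matrix_def circulant2_def vec_eq_iff mat_def
          Transposition.transpose_def)
    thus ?case by (simp add: circulant2_zariski_closure_U3[OF 4])
  next
    case (5 m n c)
    have "complex_matrix (\<chi> i j. if i = m \<and> j = n then c else of_bool (i = j)) =
        (\<chi> i j. if i = m \<and> j = n then of_real c else of_bool (i = j))"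
      by (auto simp: complex_matrix_def vec_eq_iff)
    thus ?case by (simp add: transvection_zariski_closure_U3[OF 5])
  qed
  thus ?thesis using assms by blast
qed

theorem zariski_closure_U3: "zariski_closure U3 = UNIV"
proof -
  have real: "complex_matrix A \<in> zariski_closure U3" for A
  proof -
    \<comment> \<open>On the line from the identity to \<open>A\<close> the determinant is 1 at
      \<open>t = 0\<close>, so infinitely many real parameters give invertible matrices and
      \<open>t = 1\<close> is reached even if \<open>A\<close> is singular.\<close>
    let ?\<phi> = "\<lambda>t. \<chi> i j. mat 1 $ i $ j + t * (complex_matrix A $ i $ j - mat 1 $ i $ j)"
    have poly: "(\<lambda>t. ?\<phi> t $ i $ j) \<in> polys_in {\<lambda>t. t}" for i j
      by (simp, intro polys_in_intros polys_in_id)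
    let ?T = "{t \<in> \<real>. det (?\<phi> t) \<noteq> 0}"
    have "infinite ?T"
    proof
      assume "finite ?T"
      hence "infinite (\<real> - ?T)" using infinite_complex_Reals by simp
      from polys_in_univariate_eq_0[OF polys_in_det[OF poly] this, of 0]
      have "det (?\<phi> 0) = 0" by auto
      thus False by (simp add: det_3 mat_def)
    qed
    hence "?\<phi> 1 \<in> zariski_closure U3"
    proof (rule zariski_closure_curve[OF poly])
      fix t assume t: "t \<in> ?T"
      then obtain r where r: "t = of_real r" by (auto elim: Reals_cases)
      have "?\<phi> t = complex_matrix (\<chi> i j. mat 1 $ i $ j + r * (A $ i $ j - mat 1 $ i $ j))"
        by (simp add: complex_matrix_def vec_eq_iff r mat_def)
      thus "?\<phi> t \<in> zariski_closure U3"
        using complex_matrix_zariski_closure_U3 t by simp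
    qed
    moreover have "?\<phi> 1 = complex_matrix A" by (simp add: vec_eq_iff)
    ultimately show ?thesis by simp
  qed
  have "A \<in> zariski_closure U3" for A
  proof -
    \<comment> \<open>Real \<open>t\<close> gives real matrices, and \<open>t = \<i>\<close> gives
      \<open>A\<close>.\<close>
    let ?\<phi> = "\<lambda>t. \<chi> i j. of_real (Re (A $ i $ j)) + t * of_real (Im (A $ i $ j))"
    have "?\<phi> \<i> \<in> zariski_closure U3"
    proof (rule zariski_closure_curve[OF _ infinite_complex_Reals])
      fix t :: complex assume "t \<in> \<real>"
      then obtain r where r: "t = of_real r" by (auto elim: Reals_cases)
      have "?\<phi> t = complex_matrix (\<chi> i j. Re (A $ i $ j) + r * Im (A $ i $ j))"
        by (simp add: complex_matrix_def vec_eq_iff r)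
      thus "?\<phi> t \<in> zariski_closure U3" using real by simp
    qed (simp, intro polys_in_intros polys_in_id)
    moreover have "?\<phi> \<i> = A"
      by (simp add: vec_eq_iff complex_eq[symmetric])
    ultimately show ?thesis by simp
  qed
  thus ?thesis by blast
qed

lemma coordinates_vanish_on_U3:
  assumes "f \<in> polys_in coordinates" "\<And>G. G \<in> U3 \<Longrightarrow> f G = 0"
  shows "f A = 0"
  using assms zariski_closure_U3 unfolding zariski_closure_def by blast

subsection \<open>Independent variables for the adjoints\<close>

text \<open>\<open>Z (s, True)\<close> stands for \<open>\<Omega>\<^sub>s\<close> and \<open>Z (s, False)\<close> for its adjoint.\<close>

fun adjoint_pairs :: "cmat3 \<times> cmat3 \<Rightarrow> sector \<times> bool \<Rightarrow> cmat3" where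
  "adjoint_pairs (\<Omega>u, \<Omega>d) (Up, b) = (if b then \<Omega>u else dagger \<Omega>u)"
| "adjoint_pairs (\<Omega>u, \<Omega>d) (Down, b) = (if b then \<Omega>d else dagger \<Omega>d)"

lemma matrix_entries_lift:
  assumes "p \<in> polys_in matrix_entries"
  shows "\<exists>f\<in>polys_in entries. \<forall>\<Omega>. p \<Omega> = f (adjoint_pairs \<Omega>)"
  using assms
proof induction
  case (const c)
  show ?case by (rule bexI[OF _ polys_in.const[of c]]) simp
next
  case (gen p)
  then obtain i j where "p \<in> {\<lambda>(\<Omega>u, \<Omega>d). \<Omega>u $ i $ j, \<lambda>(\<Omega>u, \<Omega>d). \<Omega>d $ i $ j,
              \<lambda>(\<Omega>u, \<Omega>d). dagger \<Omega>u $ i $ j, \<lambda>(\<Omega>u, \<Omega>d). dagger \<Omega>d $ i $ j}"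
    unfolding matrix_entries_def by blast
  moreover have "(\<lambda>(\<Omega>u, \<Omega>d). \<Omega>u $ i $ j) = (\<lambda>\<Omega>. adjoint_pairs \<Omega> (Up, True) $ i $ j)"
    "(\<lambda>(\<Omega>u, \<Omega>d). \<Omega>d $ i $ j) = (\<lambda>\<Omega>. adjoint_pairs \<Omega> (Down, True) $ i $ j)"
    "(\<lambda>(\<Omega>u, \<Omega>d). dagger \<Omega>u $ i $ j) = (\<lambda>\<Omega>. adjoint_pairs \<Omega> (Up, False) $ i $ j)"
    "(\<lambda>(\<Omega>u, \<Omega>d). dagger \<Omega>d $ i $ j) = (\<lambda>\<Omega>. adjoint_pairs \<Omega> (Down, False) $ i $ j)"
    by (simp_all add: fun_eq_iff split_paired_all)
  ultimately obtain x where "p = (\<lambda>\<Omega>. adjoint_pairs \<Omega> x $ i $ j)" by auto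
  hence "\<forall>\<Omega>. p \<Omega> = adjoint_pairs \<Omega> x $ i $ j" by simp
  thus ?case by (intro bexI[OF _ polys_in.gen[OF entries_in[of x i j]]])
next
  case (add p q)
  then obtain f g where "f \<in> polys_in entries" "\<forall>\<Omega>. p \<Omega> = f (adjoint_pairs \<Omega>)"
    "g \<in> polys_in entries" "\<forall>\<Omega>. q \<Omega> = g (adjoint_pairs \<Omega>)" by blast
  thus ?case by (intro bexI[of _ "\<lambda>Z. f Z + g Z"]) (simp_all add: polys_in.add)
next
  case (mult p q)
  then obtain f g where "f \<in> polys_in entries" "\<forall>\<Omega>. p \<Omega> = f (adjoint_pairs \<Omega>)"
    "g \<in> polys_in entries" "\<forall>\<Omega>. q \<Omega> = g (adjoint_pairs \<Omega>)" by blast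
  thus ?case by (intro bexI[of _ "\<lambda>Z. f Z * g Z"]) (simp_all add: polys_in.mult)
qed

lemma sector_bool_cases:
  obtains "x = (Up, True)" | "x = (Up, False)" | "x = (Down, True)" | "x = (Down, False)"
  by (cases x; cases "fst x"; cases "snd x") auto

text \<open>Adjoint pairs are the fixed points of an antilinear involution. \<open>P\<close> and
  \<open>Q\<close> are the real and imaginary parts of \<open>Z\<close> for it: their real
  combinations are adjoint pairs, and \<open>P + \<i> Q = Z\<close>.\<close>

lemma adjoint_pairs_vanish:
  assumes f: "f \<in> polys_in entries" and vanish: "\<And>\<Omega>. f (adjoint_pairs \<Omega>) = 0"
  shows "f Z = 0"
proof -
  define P :: "sector \<times> bool \<Rightarrow> cmat3" where
    "P = (\<lambda>(s, b). \<chi> i j. if b then (Z (s, True) $ i $ j + cnj (Z (s, False) $ j $ i)) / 2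
        else cnj ((Z (s, True) $ j $ i + cnj (Z (s, False) $ i $ j)) / 2))"
  define Q :: "sector \<times> bool \<Rightarrow> cmat3" where
    "Q = (\<lambda>(s, b). \<chi> i j. if b then (Z (s, True) $ i $ j - cnj (Z (s, False) $ j $ i)) / (2 * \<i>)
        else cnj ((Z (s, True) $ j $ i - cnj (Z (s, False) $ i $ j)) / (2 * \<i>)))"
  have "f (\<lambda>x. \<chi> i j. P x $ i $ j + of_real t * Q x $ i $ j) = 0" for t
  proof -
    let ?A = "\<lambda>s. \<chi> i j. P (s, True) $ i $ j + of_real t * Q (s, True) $ i $ j"
    have "(\<lambda>x. \<chi> i j. P x $ i $ j + of_real t * Q x $ i $ j) = adjoint_pairs (?A Up, ?A Down)"
    proof
      fix x
      show "(\<chi> i j. P x $ i $ j + of_real t * Q x $ i $ j) = adjoint_pairs (?A Up, ?A Down) x"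
        by (cases x rule: sector_bool_cases) (simp_all add: P_def Q_def vec_eq_iff)
    qed
    thus ?thesis using vanish by simp
  qed
  from entries_vanish_complexification[OF f this]
  have "f (\<lambda>x. \<chi> i j. P x $ i $ j + \<i> * Q x $ i $ j) = 0" .
  moreover have "(\<lambda>x. \<chi> i j. P x $ i $ j + \<i> * Q x $ i $ j) = Z"
  proof
    fix x
    show "(\<chi> i j. P x $ i $ j + \<i> * Q x $ i $ j) = Z x"
      by (cases x rule: sector_bool_cases) (simp_all add: P_def Q_def vec_eq_iff field_simps)
  qed
  ultimately show ?thesis by simp
qed

text \<open>The adjoint slot gets the transformation that an adjoint would have. The formula is
  linear in \<open>Z\<close> and does not require the two slots to be related.\<close>

definition frame_act :: "cmat3 \<Rightarrow> (sector \<Rightarrow> cmat3) \<Rightarrow> (sector \<times> bool \<Rightarrow> cmat3) \<Rightarrow> sector \<times> bool \<Rightarrow> cmat3" where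
  "frame_act GQ G Z = (\<lambda>(s, b). if b then GQ ** Z (s, True) ** dagger (G s)
     else G s ** Z (s, False) ** dagger GQ)"

lemma adjoint_pairs_flavour_act:
  "adjoint_pairs (flavour_act (GQ, G Up, G Down) \<Omega>) = frame_act GQ G (adjoint_pairs \<Omega>)"
proof
  fix x
  obtain \<Omega>u \<Omega>d where "\<Omega> = (\<Omega>u, \<Omega>d)" by (cases \<Omega>)
  thus "adjoint_pairs (flavour_act (GQ, G Up, G Down) \<Omega>) x = frame_act GQ G (adjoint_pairs \<Omega>) x"
    by (cases x rule: sector_bool_cases) (simp_all add: frame_act_def dagger_mult matrix_mul_assoc)
qed

lemma polys_in_frame_act:
  assumes "f \<in> polys_in entries"
  shows "(\<lambda>Z. f (frame_act GQ G Z)) \<in> polys_in entries"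
proof (rule polys_in_entries_comp[OF assms])
  fix x :: "sector \<times> bool" and i j
  obtain s b where "x = (s, b)" by (cases x)
  thus "(\<lambda>Z. frame_act GQ G Z x $ i $ j) \<in> polys_in entries"
    by (cases b) (simp_all add: frame_act_def polys_in_matrix_mult polys_in.const polys_in.gen entries_in)
qed

lemma frame_act_invariant:
  assumes f: "f \<in> polys_in entries" and "\<And>\<Omega>. f (adjoint_pairs (flavour_act (GQ, G Up, G Down) \<Omega>)) = f (adjoint_pairs \<Omega>)"
  shows "f (frame_act GQ G Z) = f Z"
proof -
  have "(\<lambda>Z. f (frame_act GQ G Z) - f Z) \<in> polys_in entries"
    by (intro polys_in_diff polys_in_frame_act f)
  from adjoint_pairs_vanish[OF this, of Z] show ?thesis
    using assms(2) by (simp add: adjoint_pairs_flavour_act)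
qed

subsection \<open>Elimination of the right factors\<close>

text \<open>The distinguished sector \<open>s\<close> may be either one, so a single argument covers
  both signs of the weight.\<close>

definition sector_quadruple :: "sector \<Rightarrow> cmat3 \<Rightarrow> cmat3 \<Rightarrow> cmat3 \<Rightarrow> cmat3 \<Rightarrow> sector \<times> bool \<Rightarrow> cmat3" where
  "sector_quadruple s A B C D = (\<lambda>(r, b). if r = s then (if b then A else B) else (if b then C else D))"

lemma sector_neq_iff: "t \<noteq> s \<Longrightarrow> r = t \<longleftrightarrow> r \<noteq> (s :: sector)"
  by (cases r; cases s; cases t) auto

lemma frame_act_sector_quadruple:
  "frame_act (mat 1) ((\<lambda>_. mat 1)(s := dagger G)) (sector_quadruple s A B C D)
     = sector_quadruple s (A ** G) (dagger G ** B) C D"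
  "t \<noteq> s \<Longrightarrow> frame_act (mat 1) ((\<lambda>_. mat 1)(t := dagger G)) (sector_quadruple s A B C D)
     = sector_quadruple s A B (C ** G) (dagger G ** D)"
  "frame_act G (\<lambda>_. mat 1) (sector_quadruple s A B C D)
     = sector_quadruple s (G ** A) (B ** dagger G) (G ** C) (D ** dagger G)"
  by (auto simp: frame_act_def sector_quadruple_def fun_eq_iff sector_neq_iff)

lemma polys_in_sector_quadruple:
  assumes "f \<in> polys_in entries"
    and "\<And>i j. (\<lambda>x. A x $ i $ j) \<in> polys_in S" "\<And>i j. (\<lambda>x. B x $ i $ j) \<in> polys_in S"
      "\<And>i j. (\<lambda>x. C x $ i $ j) \<in> polys_in S" "\<And>i j. (\<lambda>x. D x $ i $ j) \<in> polys_in S"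
  shows "(\<lambda>x. f (sector_quadruple s (A x) (B x) (C x) (D x))) \<in> polys_in S"
proof (rule polys_in_entries_comp[OF assms(1)])
  fix y i j
  show "(\<lambda>x. sector_quadruple s (A x) (B x) (C x) (D x) y $ i $ j) \<in> polys_in S"
    by (cases "fst y = s"; cases "snd y") (simp_all add: sector_quadruple_def case_prod_unfold assms)
qed

lemma eq_on_U3_imp_eq:
  assumes "(\<lambda>G. f G) \<in> polys_in coordinates" "(\<lambda>G. g G) \<in> polys_in coordinates"
    and "\<And>G. G \<in> U3 \<Longrightarrow> f G = g G"
  shows "f G = g G"
  using coordinates_vanish_on_U3[OF polys_in_diff[OF assms(1,2)], of G] assms(3) by simp

lemma det_mult_det_dagger:
  assumes "G \<in> U3"
  shows "det G * det (dagger G) = 1"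
  using U3_inverse(1)[OF assms] by (metis det_I det_mul)

text \<open>Covariance under \<open>U3\<close> is a polynomial identity in \<open>G\<close> once \<open>G\<^sup>\<dagger>\<close> is moved to the other side,
  so it holds for every matrix \<open>G\<close>; choosing \<open>G = A\<close> and \<open>G = D\<close> leaves a function of
  \<open>A B\<close> and \<open>C D\<close> only.\<close>

lemma right_covariant_factorisation:
  fixes k :: nat
  assumes f: "f \<in> polys_in entries" and st: "t \<noteq> s"
    and cov_s: "\<And>G Z. G \<in> U3 \<Longrightarrow> f (frame_act (mat 1) ((\<lambda>_. mat 1)(s := dagger G)) Z) = det G ^ k * f Z"
    and cov_t: "\<And>G Z. G \<in> U3 \<Longrightarrow> det G ^ k * f (frame_act (mat 1) ((\<lambda>_. mat 1)(t := dagger G)) Z) = f Z"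
    and inv_Q: "\<And>G Z. G \<in> U3 \<Longrightarrow> f (frame_act G (\<lambda>_. mat 1) Z) = f Z"
  shows "\<exists>q\<in>polys_in trace_words. \<forall>A B C D. f (sector_quadruple s A B C D)
     = det A ^ k * det D ^ k * q (\<lambda>r. if r = s then A ** B else C ** D)"
proof -
  let ?h = "\<lambda>A B C D. f (sector_quadruple s A B C D)"
  note poly = polys_in_sector_quadruple[OF f] polys_in_intros polys_in_coordinate
  have s_U3: "?h (A ** G) B C D = det G ^ k * ?h A (G ** B) C D" if "G \<in> U3" for A B C D G
    using cov_s[OF that, of "sector_quadruple s A (G ** B) C D"] U3_inverse[OF that]
    by (simp add: frame_act_sector_quadruple matrix_mul_assoc)
  have "?h (A ** G) B C D = det G ^ k * ?h A (G ** B) C D" for A B C D G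
    by (rule eq_on_U3_imp_eq[of "\<lambda>G. ?h (A ** G) B C D" "\<lambda>G. det G ^ k * ?h A (G ** B) C D"])
      (intro poly | erule s_U3)+
  \<comment> \<open>With the identity as first argument, the now arbitrary \<open>G\<close> takes
    over its place.\<close>
  from this[where A = "mat 1"] have s: "?h A B C D = det A ^ k * ?h (mat 1) (A ** B) C D" for A B C D
    unfolding matrix_mul_lid .
  have t_U3: "det G ^ k * ?h A B (C ** G) D = ?h A B C (G ** D)" if "G \<in> U3" for A B C D G
    using cov_t[OF that, of "sector_quadruple s A B C (G ** D)"] U3_inverse[OF that]
    by (simp add: frame_act_sector_quadruple st matrix_mul_assoc)
  have "det G ^ k * ?h A B (C ** G) D = ?h A B C (G ** D)" for A B C D G
    by (rule eq_on_U3_imp_eq[of "\<lambda>G. det G ^ k * ?h A B (C ** G) D" "\<lambda>G. ?h A B C (G ** D)"])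
      (intro poly | erule t_U3)+
  \<comment> \<open>The weight of \<open>t\<close> is opposite, so its determinant is taken from
    \<open>D\<close>; taking it from \<open>C\<close> would require negative powers.\<close>
  from this[where D = "mat 1", symmetric]
  have t: "?h A B C D = det D ^ k * ?h A B (C ** D) (mat 1)" for A B C D
    unfolding matrix_mul_rid .
  define q where "q = (\<lambda>Y. ?h (mat 1) (Y s) (Y t) (mat 1))"
  have h: "?h A B C D = det A ^ k * det D ^ k * q (\<lambda>r. if r = s then A ** B else C ** D)" for A B C D
    unfolding s[of A B C D] t[of "mat 1" "A ** B" C D] using st by (simp add: q_def)
  have q: "q \<in> polys_in entries"
    unfolding q_def by (intro polys_in_sector_quadruple[OF f] polys_in.const polys_in.gen entries_in)
  have q_U3: "q (\<lambda>r. G ** Y r) = q (\<lambda>r. Y r ** G)" if G: "G \<in> U3" for G Y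
  proof -
    have "q (\<lambda>r. Y r ** G) = ?h G (Y s) (G ** Y t ** G) (dagger G)"
      using inv_Q[OF G, of "sector_quadruple s (mat 1) (Y s ** G) (Y t ** G) (mat 1)"] U3_inverse[OF G]
      by (simp add: q_def frame_act_sector_quadruple matrix_mul_assoc[symmetric])
    \<comment> \<open>The action of U(3)_Q disturbs the two identity slots. Restoring them costs a
      determinant factor in each sector, and because the weights are opposite the two factors
      cancel.\<close>
    also have "\<dots> = (det G * det (dagger G)) ^ k * q (\<lambda>r. G ** Y r)"
      using st U3_inverse[OF G] unfolding h
      by (simp add: q_def power_mult_distrib matrix_mul_assoc[symmetric])
    finally show ?thesis using det_mult_det_dagger[OF G] by simp
  qed
  have "q (\<lambda>r. G ** Y r) = q (\<lambda>r. Y r ** G)" for G Y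
    by (rule eq_on_U3_imp_eq[of "\<lambda>G. q (\<lambda>r. G ** Y r)" "\<lambda>G. q (\<lambda>r. Y r ** G)"])
      (intro polys_in_entries_comp[OF q] polys_in_intros polys_in_coordinate | erule q_U3)+
  hence "q \<in> polys_in trace_words"
    by (rule conjugation_invariant_polys_in_trace_words[OF q])
  thus ?thesis using h by blast
qed

lemma X_word_eq: "X_word \<Omega> w = matrix_word (X_mat \<Omega>) w"
  by (simp add: X_word_def matrix_word_def)

lemma trace_words_X_mat:
  assumes "q \<in> polys_in trace_words"
  shows "(\<lambda>\<Omega>. q (X_mat \<Omega>)) \<in> polys_in word_traces"
  by (rule polys_in_comp[OF assms])
    (auto simp: trace_words_def word_traces_def X_word_eq intro!: polys_in.gen)

fun sector_matrix :: "sector \<Rightarrow> cmat3 \<times> cmat3 \<Rightarrow> cmat3" where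
  "sector_matrix Up (\<Omega>u, \<Omega>d) = \<Omega>u"
| "sector_matrix Down (\<Omega>u, \<Omega>d) = \<Omega>d"

lemma adjoint_pairs_sector_quadruple:
  assumes "t \<noteq> s"
  shows "adjoint_pairs \<Omega> = sector_quadruple s (sector_matrix s \<Omega>) (dagger (sector_matrix s \<Omega>))
     (sector_matrix t \<Omega>) (dagger (sector_matrix t \<Omega>))"
proof
  fix x
  show "adjoint_pairs \<Omega> x = sector_quadruple s (sector_matrix s \<Omega>) (dagger (sector_matrix s \<Omega>))
     (sector_matrix t \<Omega>) (dagger (sector_matrix t \<Omega>)) x"
    using assms by (cases \<Omega>; cases x rule: sector_bool_cases; cases s; cases t)
      (simp_all add: sector_quadruple_def)
qed

lemma X_mat_sectors:
  assumes "t \<noteq> s"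
  shows "X_mat \<Omega> = (\<lambda>r. if r = s then sector_matrix s \<Omega> ** dagger (sector_matrix s \<Omega>)
     else sector_matrix t \<Omega> ** dagger (sector_matrix t \<Omega>))"
proof
  fix r
  show "X_mat \<Omega> r = (if r = s then sector_matrix s \<Omega> ** dagger (sector_matrix s \<Omega>)
     else sector_matrix t \<Omega> ** dagger (sector_matrix t \<Omega>))"
    using assms by (cases \<Omega>; cases r; cases s; cases t) simp_all
qed

lemma right_covariant_word_traces:
  fixes k :: nat
  assumes f: "f \<in> polys_in entries" and st: "t \<noteq> s"
    and "\<And>G Z. G \<in> U3 \<Longrightarrow> f (frame_act (mat 1) ((\<lambda>_. mat 1)(s := dagger G)) Z) = det G ^ k * f Z"
    and "\<And>G Z. G \<in> U3 \<Longrightarrow> det G ^ k * f (frame_act (mat 1) ((\<lambda>_. mat 1)(t := dagger G)) Z) = f Z"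
    and "\<And>G Z. G \<in> U3 \<Longrightarrow> f (frame_act G (\<lambda>_. mat 1) Z) = f Z"
  shows "\<exists>q\<in>polys_in word_traces. \<forall>\<Omega>. f (adjoint_pairs \<Omega>)
     = det (sector_matrix s \<Omega>) ^ k * cnj (det (sector_matrix t \<Omega>)) ^ k * q \<Omega>"
proof -
  obtain q where q: "q \<in> polys_in trace_words"
    and fq: "\<And>A B C D. f (sector_quadruple s A B C D)
     = det A ^ k * det D ^ k * q (\<lambda>r. if r = s then A ** B else C ** D)"
    using right_covariant_factorisation[OF assms] by blast
  show ?thesis
    by (rule bexI[OF _ trace_words_X_mat[OF q]])
      (simp add: adjoint_pairs_sector_quadruple[OF st] fq det_dagger X_mat_sectors[OF st])
qed

theorem G_F_invariant_word_traces:
  assumes p: "p \<in> polys_in matrix_entries" and inv: "flavour_invariant G_F p"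
  shows "p \<in> polys_in word_traces"
proof -
  obtain f where f: "f \<in> polys_in entries" and pf: "\<And>\<Omega>. p \<Omega> = f (adjoint_pairs \<Omega>)"
    using matrix_entries_lift[OF p] by blast
  have act: "f (frame_act GQ G Z) = f Z" if "GQ \<in> U3" "\<And>s. G s \<in> U3" for GQ G Z
  proof (rule frame_act_invariant[OF f])
    have "(GQ, G Up, G Down) \<in> G_F" using that by (simp add: G_F_def)
    thus "f (adjoint_pairs (flavour_act (GQ, G Up, G Down) \<Omega>)) = f (adjoint_pairs \<Omega>)" for \<Omega>
      using inv unfolding flavour_invariant_def pf by blast
  qed
  \<comment> \<open>Full invariance is covariance with \<open>k = 0\<close>.\<close>
  have "\<exists>q\<in>polys_in word_traces. \<forall>\<Omega>. f (adjoint_pairs \<Omega>)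
     = det (sector_matrix Up \<Omega>) ^ 0 * cnj (det (sector_matrix Down \<Omega>)) ^ 0 * q \<Omega>"
    by (rule right_covariant_word_traces[OF f]) (auto intro!: act simp: U3_mat_1 U3_dagger)
  then obtain q where "q \<in> polys_in word_traces" "\<And>\<Omega>. p \<Omega> = q \<Omega>" by (auto simp: pf)
  moreover from this(2) have "p = q" by (rule ext)
  ultimately show ?thesis by simp
qed

subsection \<open>Grading by the sectoral phases\<close>

text \<open>On the unit circle this is the phase action. Using \<open>inverse\<close> instead of a
  conjugate in the adjoint slot makes the dependence on \<open>c\<close> a Laurent polynomial for
  all nonzero \<open>c\<close>.\<close>

definition sector_scale :: "(sector \<Rightarrow> complex) \<Rightarrow> (sector \<times> bool \<Rightarrow> cmat3) \<Rightarrow> sector \<times> bool \<Rightarrow> cmat3" where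
  "sector_scale c Z = (\<lambda>(s, b). \<chi> i j. (if b then c s else inverse (c s)) * Z (s, b) $ i $ j)"

definition sector_weight :: "sector \<Rightarrow> ((sector \<times> bool) \<times> 3 \<times> 3) list \<Rightarrow> int" where
  "sector_weight s L = (\<Sum>((r, b), i, j)\<leftarrow>L. if r = s then (if b then 1 else -1) else 0)"

definition has_weights :: "int \<Rightarrow> int \<Rightarrow> ((sector \<times> bool \<Rightarrow> cmat3) \<Rightarrow> complex) \<Rightarrow> bool" where
  "has_weights m n f \<longleftrightarrow> (\<forall>c Z. (\<forall>s. c s \<noteq> 0) \<longrightarrow>
     f (sector_scale c Z) = c Up powi m * c Down powi n * f Z)"

lemma has_weights_list_monomial:
  "has_weights (sector_weight Up L) (sector_weight Down L) (list_monomial L)"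
  unfolding has_weights_def
proof (intro allI impI)
  fix c :: "sector \<Rightarrow> complex" and Z
  assume c: "\<forall>s. c s \<noteq> 0"
  show "list_monomial L (sector_scale c Z)
      = c Up powi sector_weight Up L * c Down powi sector_weight Down L * list_monomial L Z"
  proof (induction L)
    case Nil
    show ?case by (simp add: list_monomial_def sector_weight_def)
  next
    case (Cons x L)
    obtain y i j where x: "x = (y, i, j)" by (cases x)
    show ?case
      using Cons c unfolding x
      by (cases y rule: sector_bool_cases)
        (simp_all add: list_monomial_def sector_weight_def sector_scale_def power_int_add
          power_int_diff field_simps)
  qed
qed

lemma weight_decomposition:
  assumes "f \<in> polys_in (entries :: ((sector \<times> bool \<Rightarrow> cmat3) \<Rightarrow> complex) set)"
  shows "\<exists>M N F. finite M \<and> finite N \<and> (\<forall>m n. F m n \<in> polys_in entries \<and> has_weights m n (F m n)) \<and>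
    (\<forall>Z. f Z = (\<Sum>m\<in>M. \<Sum>n\<in>N. F m n Z))"
proof -
  obtain xs where xs: "\<And>Z. f Z = (\<Sum>(c, L)\<leftarrow>xs. c * list_monomial L Z)"
    using polys_in_entries_monomials[OF assms] by blast
  \<comment> \<open>Defined for all integers \<open>m\<close>, \<open>n\<close>: absent weights give
    the zero function, which has every weight.\<close>
  define F where "F = (\<lambda>xs m n Z. \<Sum>(c, L)\<leftarrow>xs.
    if sector_weight Up L = m \<and> sector_weight Down L = n then c * list_monomial L Z else 0)"
  have poly: "F xs m n \<in> polys_in entries" and weights: "has_weights m n (F xs m n)" for xs m n
  proof (induction xs)
    case Nil
    case 1 show ?case by (simp add: F_def polys_in.const)
    case 2 show ?case by (simp add: F_def has_weights_def)
  next
    case (Cons x xs)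
    obtain c L where x: "x = (c, L)" by (cases x)
    have *: "F (x # xs) m n = (\<lambda>Z. (if sector_weight Up L = m \<and> sector_weight Down L = n
        then c * list_monomial L Z else 0) + F xs m n Z)"
      by (simp add: F_def x)
    case 1 show ?case unfolding *
      using Cons.IH(1) by (intro polys_in.add polys_in_if polys_in.mult polys_in.const list_monomial_polys_in)
    case 2 show ?case unfolding *
      using Cons.IH(2) has_weights_list_monomial[of L]
      by (auto simp: has_weights_def algebra_simps)
  qed
  have sum: "(\<Sum>m\<in>M. \<Sum>n\<in>N. F xs m n Z) = (\<Sum>(c, L)\<leftarrow>xs. c * list_monomial L Z)"
    if "finite M" "finite N" "\<forall>(c, L)\<in>set xs. sector_weight Up L \<in> M \<and> sector_weight Down L \<in> N"
    for M N xs Z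
    using that(3)
  proof (induction xs)
    case Nil
    show ?case by (simp add: F_def)
  next
    case (Cons x xs)
    obtain c L where x: "x = (c, L)" by (cases x)
    have "(\<Sum>m\<in>M. \<Sum>n\<in>N. F (x # xs) m n Z) = (\<Sum>m\<in>M. \<Sum>n\<in>N.
        if sector_weight Up L = m \<and> sector_weight Down L = n then c * list_monomial L Z else 0)
        + (\<Sum>m\<in>M. \<Sum>n\<in>N. F xs m n Z)"
      unfolding sum.distrib[symmetric] by (simp add: F_def x)
    also have "(\<Sum>m\<in>M. \<Sum>n\<in>N.
        if sector_weight Up L = m \<and> sector_weight Down L = n then c * list_monomial L Z else 0)
        = (\<Sum>m\<in>M. if sector_weight Up L = m then c * list_monomial L Z else 0)"
      using Cons.prems x that(2) by (intro sum.cong) auto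
    also have "\<dots> = c * list_monomial L Z"
      using Cons.prems x that(1) by simp
    finally show ?case using Cons x by simp
  qed
  let ?M = "sector_weight Up ` snd ` set xs" and ?N = "sector_weight Down ` snd ` set xs"
  have "f Z = (\<Sum>m\<in>?M. \<Sum>n\<in>?N. F xs m n Z)" for Z
  proof -
    have "\<forall>(c, L)\<in>set xs. sector_weight Up L \<in> ?M \<and> sector_weight Down L \<in> ?N" by force
    from sum[OF _ _ this] show ?thesis by (simp add: xs)
  qed
  thus ?thesis using poly weights by (intro exI[of _ ?M] exI[of _ ?N] exI[of _ "F xs"]) blast
qed

text \<open>Multiplication by \<open>z powi (- B)\<close>, with \<open>B\<close> below all
  exponents, yields a polynomial with infinitely many roots.\<close>

lemma laurent_coefficients_eq_0:
  fixes y :: "int \<Rightarrow> complex"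
  assumes M: "finite M" and zero: "\<And>z. z \<noteq> 0 \<Longrightarrow> (\<Sum>m\<in>M. z powi m * y m) = 0" and m: "m \<in> M"
  shows "y m = 0"
proof -
  obtain B where B: "\<And>m. m \<in> M \<Longrightarrow> B \<le> m"
    using bdd_below_finite[OF M] by (auto simp: bdd_below_def)
  define p where "p = (\<Sum>m\<in>M. Polynomial.monom (y m) (nat (m - B)))"
  have "poly p z = 0" if z: "z \<noteq> 0" for z
  proof -
    have "poly p z = (\<Sum>m\<in>M. z powi (- B) * (z powi m * y m))"
      unfolding p_def poly_sum
    proof (intro sum.cong refl)
      fix m assume "m \<in> M"
      have "z ^ nat (m - B) = z powi (m - B)"
        using B[OF \<open>m \<in> M\<close>] by (simp add: power_int_def)
      also have "\<dots> = z powi (- B) * z powi m" using z by (simp add: power_int_diff power_int_minus field_simps)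
      finally show "poly (Polynomial.monom (y m) (nat (m - B))) z = z powi (- B) * (z powi m * y m)"
        by (simp add: poly_monom mult_ac)
    qed
    thus ?thesis using zero[OF z] by (simp add: sum_distrib_left[symmetric])
  qed
  hence "UNIV - {0} \<subseteq> {z. poly p z = 0}" by auto
  moreover have "infinite (UNIV - {0 :: complex})" by (simp add: infinite_UNIV_char_0)
  ultimately have "p = 0" using poly_roots_finite finite_subset by blast
  moreover have "Polynomial.coeff p (nat (m - B)) = (\<Sum>k\<in>M. if nat (k - B) = nat (m - B) then y k else 0)"
    by (simp add: p_def Polynomial.coeff_sum)
  ultimately have "0 = (\<Sum>k\<in>M. if nat (k - B) = nat (m - B) then y k else 0)" by simp
  also have "\<dots> = (\<Sum>k\<in>M. if k = m then y k else 0)"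
  proof (intro sum.cong refl)
    fix k assume "k \<in> M"
    hence "nat (k - B) = nat (m - B) \<longleftrightarrow> k = m"
      using B[of k] B[OF m] by (simp add: eq_nat_nat_iff)
    thus "(if nat (k - B) = nat (m - B) then y k else 0) = (if k = m then y k else 0)" by simp
  qed
  finally show ?thesis using M m by simp
qed

lemma frame_act_sector_scale:
  "frame_act GQ G (sector_scale c Z) = sector_scale c (frame_act GQ G Z)"
proof
  fix x
  have *: "A ** (\<chi> i j. k * B $ i $ j) ** C = (\<chi> i j. k * (A ** B ** C) $ i $ j)"
    for k :: complex and A B C :: cmat3
    by (simp add: vec_eq_iff matrix_matrix_mult_def sum_distrib_left sum_distrib_right mult_ac)
  show "frame_act GQ G (sector_scale c Z) x = sector_scale c (frame_act GQ G Z) x"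
    by (cases x; cases "snd x") (simp_all add: frame_act_def sector_scale_def *)
qed

text \<open>Scaling commutes with the action, so invariance of \<open>f\<close> at all rescaled
  points is a Laurent identity in two variables whose coefficients are the defects of invariance of
  the components.\<close>

lemma weight_components_invariant:
  assumes M: "finite M" "finite N" and weights: "\<And>m n. has_weights m n (F m n)"
    and f: "\<And>Z. f Z = (\<Sum>m\<in>M. \<Sum>n\<in>N. F m n Z)"
    and inv: "\<And>Z. f (frame_act GQ G Z) = f Z" and mn: "m \<in> M" "n \<in> N"
  shows "F m n (frame_act GQ G Z) = F m n Z"
proof -
  let ?d = "\<lambda>m n. F m n (frame_act GQ G Z) - F m n Z"
  have "(\<Sum>m\<in>M. z powi m * (\<Sum>n\<in>N. w powi n * ?d m n)) = 0" if zw: "z \<noteq> 0" "w \<noteq> 0" for z w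
  proof -
    let ?c = "\<lambda>s. case s of Up \<Rightarrow> z | Down \<Rightarrow> w"
    have c: "\<forall>s. ?c s \<noteq> 0" using zw by (auto split: sector.split)
    have "f (frame_act GQ G (sector_scale ?c Z)) - f (sector_scale ?c Z) = 0" using inv by simp
    thus ?thesis
      using weights c unfolding f frame_act_sector_scale
      by (simp add: has_weights_def sum_subtractf[symmetric] sum_distrib_left algebra_simps)
  qed
  from laurent_coefficients_eq_0[OF M(1) this mn(1)]
  have "(\<Sum>n\<in>N. w powi n * ?d m n) = 0" if "w \<noteq> 0" for w using that by blast
  from laurent_coefficients_eq_0[OF M(2) this mn(2)] show ?thesis by simp
qed

abbreviation weight_of :: "int \<Rightarrow> int \<Rightarrow> sector \<Rightarrow> int" where
  "weight_of m n s \<equiv> (case s of Up \<Rightarrow> m | Down \<Rightarrow> n)"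

lemma has_weights_single:
  assumes "has_weights m n f" "c \<noteq> 0"
  shows "f (sector_scale ((\<lambda>_. 1)(s := c)) Z) = c powi weight_of m n s * f Z"
  using assms by (cases s) (simp_all add: has_weights_def)

lemma cmod_det_U3: "G \<in> U3 \<Longrightarrow> cmod (det G) = 1"
  using det_mult_det_dagger[of G] unfolding det_dagger complex_norm_square[symmetric]
  by (metis norm_ge_zero of_real_eq_1_iff power2_eq_iff_nonneg one_power2 zero_le_one)

text \<open>A unitary \<open>G\<close> is \<open>c H\<close> with \<open>c\<^sup>3 = det G\<close> and \<open>H \<in> SU3\<close>.\<close>

lemma right_covariant_of_SU3_invariant:
  assumes weights: "has_weights m n f"
    and inv: "\<And>G Z. (\<And>s. G s \<in> SU3) \<Longrightarrow> f (frame_act (mat 1) G Z) = f Z"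
    and G: "G \<in> U3" and c: "c ^ 3 = det G"
  shows "f (frame_act (mat 1) ((\<lambda>_. mat 1)(s := dagger G)) Z) = c powi weight_of m n s * f Z"
proof -
  have "cmod c ^ 3 = 1" using cmod_det_U3[OF G] c by (metis norm_power)
  hence c1: "cmod c = 1" using power_eq_iff_eq_base[of 3 "cmod c" 1] by simp
  hence cc: "c * cnj c = 1" "c \<noteq> 0" using cmod_1_mult_cnj by auto
  hence inv_c: "inverse c = cnj c" by (simp add: inverse_unique)
  define H where "H = (\<chi> i j. cnj c * G $ i $ j)"
  have H: "G = (\<chi> i j. c * H $ i $ j)" using cc by (simp add: H_def vec_eq_iff mult.assoc[symmetric])
  have "H ** dagger H = G ** dagger G" "dagger H ** H = dagger G ** G"
    using cc unfolding H_def vec_eq_iff matrix_matrix_mult_def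
    by (auto intro!: sum.cong simp: mult_ac)
  hence "H \<in> U3" using G by (simp add: U3_def)
  moreover have "det H = 1"
  proof -
    have "det H = cnj c ^ 3 * det G" by (simp add: H_def det_3 algebra_simps power3_eq_cube)
    also have "\<dots> = (c * cnj c) ^ 3" by (simp add: c[symmetric] power_mult_distrib)
    finally show ?thesis using cc by simp
  qed
  ultimately have "dagger H \<in> SU3" by (simp add: SU3_def U3_dagger det_dagger)
  moreover have "mat 1 \<in> SU3" by (simp add: SU3_def U3_mat_1)
  ultimately have "f (frame_act (mat 1) ((\<lambda>_. mat 1)(s := dagger H)) Z) = f Z" by (intro inv) simp
  moreover have "frame_act (mat 1) ((\<lambda>_. mat 1)(s := dagger G)) Z
      = sector_scale ((\<lambda>_. 1)(s := c)) (frame_act (mat 1) ((\<lambda>_. mat 1)(s := dagger H)) Z)"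
    unfolding H frame_act_def sector_scale_def
    by (auto simp: fun_eq_iff vec_eq_iff matrix_matrix_mult_def sum_distrib_left inv_c mult_ac)
  ultimately show ?thesis using has_weights_single[OF weights cc(2)] by simp
qed

text \<open>The center of SU(3) consists of the cube roots of unity. The identity is
  \<open>c H\<close> with \<open>c\<close> such a root and \<open>H\<close> in SU(3), so a primitive
  \<open>c\<close> must satisfy \<open>c powi k = 1\<close> on a nonzero component.\<close>

lemma weight_divisible_by_3:
  assumes weights: "has_weights m n f" and nonzero: "f Z \<noteq> 0"
    and inv: "\<And>G Z. (\<And>s. G s \<in> SU3) \<Longrightarrow> f (frame_act (mat 1) G Z) = f Z"
  shows "3 dvd weight_of m n s"
proof -
  let ?w = "Complex (-1/2) (sqrt 3 / 2)" and ?k = "weight_of m n s"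
  have w3: "?w ^ 3 = 1" by (simp add: power3_eq_cube complex_eq_iff)
  have w1: "?w \<noteq> 1" "?w ^ 2 \<noteq> 1" by (simp_all add: power2_eq_square complex_eq_iff)
  have "(\<lambda>_. mat 1)(s := dagger (mat 1)) = (\<lambda>_. mat 1)" by auto
  hence "f (frame_act (mat 1) (\<lambda>_. mat 1) Z) = ?w powi ?k * f Z"
    using right_covariant_of_SU3_invariant[OF weights inv U3_mat_1, of ?w s Z] w3 by simp
  moreover have "f (frame_act (mat 1) (\<lambda>_. mat 1) Z) = f Z"
    by (rule inv) (simp add: SU3_def U3_mat_1)
  ultimately have one: "?w powi ?k = 1" using nonzero by simp
  have "?w powi ?k = ?w powi (3 * (?k div 3) + ?k mod 3)" by simp
  also have "\<dots> = (?w powi 3) powi (?k div 3) * ?w powi (?k mod 3)"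
    using w3 by (subst power_int_add) (auto simp: power_int_mult)
  also have "\<dots> = ?w ^ nat (?k mod 3)" using w3 by (simp add: power_int_def)
  finally have "?w ^ nat (?k mod 3) = 1" using one by simp
  moreover have "?k mod 3 = 0 \<or> ?k mod 3 = 1 \<or> ?k mod 3 = 2" by presburger
  ultimately have "?k mod 3 = 0" using w1 by auto
  thus ?thesis by presburger
qed

text \<open>A scalar of U(3)_Q is indistinguishable from scaling both sectors by the same
  phase.\<close>

lemma weights_opposite:
  assumes weights: "has_weights m n f" and nonzero: "f Z \<noteq> 0"
    and inv: "\<And>G Z. G \<in> U3 \<Longrightarrow> f (frame_act G (\<lambda>_. mat 1) Z) = f Z"
  shows "m + n = 0"
proof (rule ccontr)
  assume mn: "m + n \<noteq> 0"
  \<comment> \<open>The angle is chosen so that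
    \<open>?c powi (m + n) = cis pi = -1\<close>.\<close>
  let ?c = "cis (pi / of_int (m + n))"
  have cc: "?c * cnj ?c = 1" by (rule cmod_1_mult_cnj) simp
  have "mat ?c \<in> U3"
    using cc by (simp add: U3_def vec_eq_iff matrix_matrix_mult_def mat_def forall_3 sum_3 mult.commute)
  hence "f Z = f (frame_act (mat ?c) (\<lambda>_. mat 1) Z)" using inv by simp
  also have "frame_act (mat ?c) (\<lambda>_. mat 1) Z = sector_scale (\<lambda>_. ?c) Z"
    by (auto simp: fun_eq_iff frame_act_def sector_scale_def vec_eq_iff matrix_matrix_mult_def mat_def
        forall_3 sum_3 cis_inverse cis_cnj mult.commute)
  also have "f \<dots> = ?c powi (m + n) * f Z"
    using weights by (simp add: has_weights_def power_int_add)
  also have "?c powi (m + n) = -1"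
    unfolding cis_power_int using mn by (simp del: of_int_add)
  finally show False using nonzero by simp
qed

lemma weight_component_polys_in:
  assumes f: "f \<in> polys_in entries" and weights: "has_weights m n f"
    and inv: "\<And>GQ G Z. GQ \<in> U3 \<Longrightarrow> (\<And>s. G s \<in> SU3) \<Longrightarrow> f (frame_act GQ G Z) = f Z"
  shows "(\<lambda>\<Omega>. f (adjoint_pairs \<Omega>)) \<in> polys_in (word_traces \<union> sector_dets)"
proof (cases "\<exists>Z. f Z \<noteq> 0")
  case False
  thus ?thesis by (simp add: polys_in.const)
next
  case True
  then obtain Z where Z: "f Z \<noteq> 0" by blast
  have SU3_1: "mat 1 \<in> SU3" by (simp add: SU3_def U3_mat_1)
  have inv_right: "f (frame_act (mat 1) G Z) = f Z" if "\<And>s. G s \<in> SU3" for G Z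
    using that by (intro inv U3_mat_1)
  have inv_left: "f (frame_act G (\<lambda>_. mat 1) Z) = f Z" if "G \<in> U3" for G Z
    using that SU3_1 by (intro inv)
  have mn: "m + n = 0" by (rule weights_opposite[OF weights Z inv_left])
  \<comment> \<open>The sector of nonnegative weight becomes \<open>s\<close>: it supplies
    \<open>det\<close>, the other sector supplies \<open>cnj det\<close>.\<close>
  obtain s t where st: "t \<noteq> s" "weight_of m n s \<ge> 0" "weight_of m n t = - weight_of m n s"
  proof (cases "m \<ge> 0")
    case True
    thus ?thesis using that[of Down Up] mn by simp
  next
    case False
    thus ?thesis using that[of Up Down] mn by simp
  qed
  obtain j where j: "weight_of m n s = 3 * j"
    using weight_divisible_by_3[OF weights Z inv_right, of s] by (auto elim: dvdE)
  define k where "k = nat j"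
  have k: "weight_of m n s = int (3 * k)" "weight_of m n t = - int (3 * k)"
    using st j by (simp_all add: k_def)
  \<comment> \<open>Any cube root serves, since it only enters to powers divisible by 3.\<close>
  have root: "\<exists>c. c ^ 3 = det G \<and> c powi int (3 * k) = det G ^ k" if "G \<in> U3" for G
  proof -
    have "det G \<noteq> 0" using cmod_det_U3[OF that] by auto
    hence "exp (Ln (det G) / 3) ^ 3 = det G" by (simp add: exp_of_nat_mult[symmetric])
    moreover from this have "exp (Ln (det G) / 3) powi int (3 * k) = det G ^ k"
      unfolding power_int_of_nat power_mult by simp
    ultimately show ?thesis by blast
  qed
  have "\<exists>q\<in>polys_in word_traces. \<forall>\<Omega>. f (adjoint_pairs \<Omega>)
     = det (sector_matrix s \<Omega>) ^ k * cnj (det (sector_matrix t \<Omega>)) ^ k * q \<Omega>"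
  proof (rule right_covariant_word_traces[OF f st(1)])
    fix G Z assume G: "G \<in> U3"
    then obtain c where c: "c ^ 3 = det G" "c powi int (3 * k) = det G ^ k" using root by blast
    note cov = right_covariant_of_SU3_invariant[OF weights inv_right G c(1)]
    show "f (frame_act (mat 1) ((\<lambda>_. mat 1)(s := dagger G)) Z) = det G ^ k * f Z"
      using cov[where s = s and Z = Z] unfolding k c .
    have "det G \<noteq> 0" using cmod_det_U3[OF G] by auto
    thus "det G ^ k * f (frame_act (mat 1) ((\<lambda>_. mat 1)(t := dagger G)) Z) = f Z"
      using cov[where s = t and Z = Z] unfolding k power_int_minus c by simp
  qed (rule inv_left)
  then obtain q where q: "q \<in> polys_in word_traces" and fq: "\<And>\<Omega>. f (adjoint_pairs \<Omega>)
     = det (sector_matrix s \<Omega>) ^ k * cnj (det (sector_matrix t \<Omega>)) ^ k * q \<Omega>" by blast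
  have dets: "(\<lambda>\<Omega>. det (sector_matrix r \<Omega>)) \<in> sector_dets"
    "(\<lambda>\<Omega>. cnj (det (sector_matrix r \<Omega>))) \<in> sector_dets" for r
    by (cases r; simp add: sector_dets_def fun_eq_iff)+
  show ?thesis unfolding fq
    by (intro polys_in.mult polys_in_power polys_in_mono[OF q] polys_in.gen UnI2 dets) auto
qed

theorem SG_F_invariant_word_traces_dets:
  assumes p: "p \<in> polys_in matrix_entries" and inv: "flavour_invariant SG_F p"
  shows "p \<in> polys_in (word_traces \<union> sector_dets)"
proof -
  obtain f where f: "f \<in> polys_in entries" and pf: "\<And>\<Omega>. p \<Omega> = f (adjoint_pairs \<Omega>)"
    using matrix_entries_lift[OF p] by blast
  have act: "f (frame_act GQ G Z) = f Z" if "GQ \<in> U3" "\<And>s. G s \<in> SU3" for GQ G Z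
  proof (rule frame_act_invariant[OF f])
    have "(GQ, G Up, G Down) \<in> SG_F" using that by (simp add: SG_F_def)
    thus "f (adjoint_pairs (flavour_act (GQ, G Up, G Down) \<Omega>)) = f (adjoint_pairs \<Omega>)" for \<Omega>
      using inv unfolding flavour_invariant_def pf by blast
  qed
  obtain M N F where MN: "finite M" "finite N"
    and F: "\<And>m n. F m n \<in> polys_in entries" "\<And>m n. has_weights m n (F m n)"
    and fF: "\<And>Z. f Z = (\<Sum>m\<in>M. \<Sum>n\<in>N. F m n Z)"
    using weight_decomposition[OF f] by blast
  have "(\<lambda>\<Omega>. F m n (adjoint_pairs \<Omega>)) \<in> polys_in (word_traces \<union> sector_dets)"
    if "m \<in> M" "n \<in> N" for m n
    by (rule weight_component_polys_in[OF F])
      (rule weight_components_invariant[OF MN F(2) fF act that])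
  hence "(\<lambda>\<Omega>. \<Sum>m\<in>M. \<Sum>n\<in>N. F m n (adjoint_pairs \<Omega>)) \<in> polys_in (word_traces \<union> sector_dets)"
    by (intro polys_in_sum)
  moreover have "p = (\<lambda>\<Omega>. \<Sum>m\<in>M. \<Sum>n\<in>N. F m n (adjoint_pairs \<Omega>))"
    by (rule ext) (simp add: pf fF)
  ultimately show ?thesis by simp
qed

subsection \<open>Dependence on the right frames\<close>

lemma polys_in_eqI:
  assumes "f \<in> polys_in S" "\<And>s. s \<in> S \<Longrightarrow> s x = s y"
  shows "f x = f y"
  using assms(1) by induction (auto simp: assms(2))

lemma is_svd_mult_dagger:
  assumes "is_svd \<Omega> U D W"
  shows "\<Omega> ** dagger \<Omega> = U ** D ** dagger D ** dagger U"
proof -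
  have "\<Omega> ** dagger \<Omega> = U ** D ** (dagger W ** W) ** dagger D ** dagger U"
    using assms by (simp add: is_svd_def dagger_mult matrix_mul_assoc)
  thus ?thesis using assms U3_inverse by (simp add: is_svd_def)
qed

lemma same_up_to_right_frames_X_mat:
  assumes "same_up_to_right_frames \<Omega> \<Omega>'"
  shows "X_mat \<Omega> = X_mat \<Omega>'"
proof
  fix s
  obtain \<Omega>u \<Omega>d \<Omega>u' \<Omega>d' where \<Omega>: "\<Omega> = (\<Omega>u, \<Omega>d)" "\<Omega>' = (\<Omega>u', \<Omega>d')"
    by (cases \<Omega>; cases \<Omega>')
  thus "X_mat \<Omega> s = X_mat \<Omega>' s"
    using assms by (cases s) (auto dest!: is_svd_mult_dagger)
qed

lemma word_traces_X_mat_eq: "X_mat \<Omega> = X_mat \<Omega>' \<Longrightarrow> \<tau> \<in> word_traces \<Longrightarrow> \<tau> \<Omega> = \<tau> \<Omega>'"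
  by (auto simp: word_traces_def X_word_eq)

lemma word_traces_right_frame_independent:
  assumes "p \<in> polys_in word_traces"
  shows "right_frame_independent p"
  unfolding right_frame_independent_def
proof (intro allI impI)
  fix \<Omega> \<Omega>' assume "same_up_to_right_frames \<Omega> \<Omega>'"
  hence "X_mat \<Omega> = X_mat \<Omega>'" by (rule same_up_to_right_frames_X_mat)
  thus "p \<Omega> = p \<Omega>'" by (intro polys_in_eqI[OF assms, of \<Omega> \<Omega>'] word_traces_X_mat_eq)
qed

lemma word_traces_dets_right_frame_independent:
  assumes "p \<in> polys_in (word_traces \<union> sector_dets)"
  shows "right_frame_independent_mod_dets p"
  unfolding right_frame_independent_mod_dets_def
proof (intro allI impI)
  fix \<Omega>u \<Omega>d \<Omega>u' \<Omega>d'
  assume *: "same_up_to_right_frames (\<Omega>u, \<Omega>d) (\<Omega>u', \<Omega>d') \<and> det \<Omega>u = det \<Omega>u' \<and> det \<Omega>d = det \<Omega>d'"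
  hence X: "X_mat (\<Omega>u, \<Omega>d) = X_mat (\<Omega>u', \<Omega>d')" by (blast intro: same_up_to_right_frames_X_mat)
  show "p (\<Omega>u, \<Omega>d) = p (\<Omega>u', \<Omega>d')"
  proof (rule polys_in_eqI[OF assms])
    fix \<tau> assume "\<tau> \<in> word_traces \<union> sector_dets"
    thus "\<tau> (\<Omega>u, \<Omega>d) = \<tau> (\<Omega>u', \<Omega>d')"
    proof
      assume "\<tau> \<in> word_traces"
      thus ?thesis by (rule word_traces_X_mat_eq[OF X])
    next
      assume "\<tau> \<in> sector_dets"
      thus ?thesis using * by (auto simp: sector_dets_def)
    qed
  qed
qed

section \<open>An invariant that does see the determinant phases\<close>

lemma is_svd_mat:
  assumes "cmod c = 1"
  shows "is_svd (mat c) (mat 1) (mat 1) (mat (cnj c))"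
  using cmod_1_mult_cnj[OF assms]
  by (simp add: is_svd_def U3_mat_1 nonneg_diagonal_def U3_def vec_eq_iff matrix_matrix_mult_def mat_def
      forall_3 sum_3 mult.commute)

text \<open>A scalar phase can be put entirely into the right frame, with identity left frame and
  identity singular values.\<close>

lemma same_up_to_right_frames_mat:
  assumes "cmod a = 1" "cmod b = 1" "cmod c = 1" "cmod d = 1"
  shows "same_up_to_right_frames (mat a, mat b) (mat c, mat d)"
  using assms is_svd_mat by (auto intro!: exI)

definition mixed_det :: "cmat3 \<times> cmat3 \<Rightarrow> complex" where
  "mixed_det = (\<lambda>(\<Omega>u, \<Omega>d). det \<Omega>u * cnj (det \<Omega>d))"

lemma mixed_det_polys_in: "mixed_det \<in> polys_in matrix_entries"
proof -
  have "(\<lambda>\<Omega> :: cmat3 \<times> cmat3. fst \<Omega> $ i $ j) \<in> polys_in matrix_entries"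
    "(\<lambda>\<Omega> :: cmat3 \<times> cmat3. dagger (snd \<Omega>) $ i $ j) \<in> polys_in matrix_entries" for i j
    unfolding matrix_entries_def
    by (rule polys_in.gen, rule UN_I[of i], simp, rule UN_I[of j], simp, simp add: case_prod_unfold fun_eq_iff)+
  hence "(\<lambda>\<Omega> :: cmat3 \<times> cmat3. det (fst \<Omega>) * det (dagger (snd \<Omega>))) \<in> polys_in matrix_entries"
    by (intro polys_in.mult polys_in_det)
  thus ?thesis by (simp add: mixed_det_def det_dagger case_prod_unfold)
qed

lemma mixed_det_invariant: "flavour_invariant SG_F mixed_det"
  unfolding flavour_invariant_def
proof (intro ballI allI)
  fix g and \<Omega> :: "cmat3 \<times> cmat3"
  assume "g \<in> SG_F"
  then obtain GQ Gu Gd where g: "g = (GQ, Gu, Gd)" "GQ \<in> U3" "det Gu = 1" "det Gd = 1"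
    by (auto simp: SG_F_def SU3_def)
  obtain \<Omega>u \<Omega>d where \<Omega>: "\<Omega> = (\<Omega>u, \<Omega>d)" by (cases \<Omega>)
  have "mixed_det (flavour_act g \<Omega>) = (det GQ * det (dagger GQ)) * mixed_det \<Omega>"
    by (simp add: g \<Omega> mixed_det_def det_mul det_dagger)
  thus "mixed_det (flavour_act g \<Omega>) = mixed_det \<Omega>"
    using det_mult_det_dagger[OF g(2)] by simp
qed

theorem mainTheorem10:
  shows "(\<forall>p \<in> polys_in matrix_entries. flavour_invariant G_F p \<longrightarrow>
            p \<in> polys_in word_traces \<and> right_frame_independent p)
       \<and> (\<forall>p \<in> polys_in matrix_entries. flavour_invariant SG_F p \<longrightarrow>
            p \<in> polys_in (word_traces \<union> sector_dets) \<and> right_frame_independent_mod_dets p)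
       \<and> (\<exists>p \<in> polys_in matrix_entries. flavour_invariant SG_F p \<and>
            (\<exists>\<Omega>u \<Omega>u' \<Omega>d. same_up_to_right_frames (\<Omega>u, \<Omega>d) (\<Omega>u', \<Omega>d) \<and>
               p (\<Omega>u, \<Omega>d) \<noteq> p (\<Omega>u', \<Omega>d)) \<and>
            (\<exists>\<Omega>u \<Omega>d \<Omega>d'. same_up_to_right_frames (\<Omega>u, \<Omega>d) (\<Omega>u, \<Omega>d') \<and>
               p (\<Omega>u, \<Omega>d) \<noteq> p (\<Omega>u, \<Omega>d')))"
proof (intro conjI ballI impI)
  fix p assume p: "p \<in> polys_in matrix_entries" "flavour_invariant G_F p"
  show "p \<in> polys_in word_traces" by (rule G_F_invariant_word_traces[OF p])
  thus "right_frame_independent p" by (rule word_traces_right_frame_independent)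
next
  fix p assume p: "p \<in> polys_in matrix_entries" "flavour_invariant SG_F p"
  show "p \<in> polys_in (word_traces \<union> sector_dets)" by (rule SG_F_invariant_word_traces_dets[OF p])
  thus "right_frame_independent_mod_dets p" by (rule word_traces_dets_right_frame_independent)
next
  \<comment> \<open>The size 3 is odd, so replacing \<open>mat 1\<close> by \<open>mat (-1)\<close>
    in either sector flips the sign.\<close>
  have "mixed_det (mat a, mat b) = a ^ 3 * cnj b ^ 3" for a b
    by (simp add: mixed_det_def det_3 mat_def power3_eq_cube)
  hence "mixed_det (mat 1, mat 1) \<noteq> mixed_det (mat (-1), mat 1)"
    "mixed_det (mat 1, mat 1) \<noteq> mixed_det (mat 1, mat (-1))" by simp_all
  moreover have "same_up_to_right_frames (mat 1, mat 1) (mat (-1), mat 1)"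
    "same_up_to_right_frames (mat 1, mat 1) (mat 1, mat (-1))"
    by (rule same_up_to_right_frames_mat; simp)+
  ultimately show "\<exists>p \<in> polys_in matrix_entries. flavour_invariant SG_F p \<and>
            (\<exists>\<Omega>u \<Omega>u' \<Omega>d. same_up_to_right_frames (\<Omega>u, \<Omega>d) (\<Omega>u', \<Omega>d) \<and>
               p (\<Omega>u, \<Omega>d) \<noteq> p (\<Omega>u', \<Omega>d)) \<and>
            (\<exists>\<Omega>u \<Omega>d \<Omega>d'. same_up_to_right_frames (\<Omega>u, \<Omega>d) (\<Omega>u, \<Omega>d') \<and>
               p (\<Omega>u, \<Omega>d) \<noteq> p (\<Omega>u, \<Omega>d'))"
    using mixed_det_polys_in mixed_det_invariant by blast
qed

end
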